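(* Let $k\in\mathbb N$ be even and $\epsilon\in(0,1)$. Let $D$ be a pseudo-distribution over $\mathbb R^d$ of degree at least $C_0k$ ($C_0$ a suitable absolute constant) that satisfies $\{\|u\|^2\le1\}$, and let $a\in\mathbb R^d$ be a unit vector. Suppose that \[ \tilde{\mathbb E}_{D(u)}\langle a,u\rangle^{k+2}\ge\frac{C_1}{\epsilon\sqrt k}\cdot\Bigl\|\tilde{\mathbb E}_{D(u)}uu^{\mathsf T}\Bigr\| \] for a suitable absolute constant $C_1$. Then, with probability at least $1/d^{O(k)}$ over $g\sim\mathcal N(0,\mathrm{Id}_d^{\otimes k})$ (a standard Gaussian vector in $(\mathbb R^d)^{\otimes k}$), the top eigenvector $u^\star$ of \[ M_g=\tilde{\mathbb E}_{D(u)}\langle g,u^{\otimes k}\rangle\,uu^{\mathsf T} \] satisfies $\langle a,u^\star\rangle^2\ge1-O(\epsilon)$.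
   Context: A degree-$t$ pseudo-distribution over $\mathbb R^d$ is a finitely supported function $D:\mathbb R^d\to\mathbb R$ with $\sum_x D(x)=1$ and $\sum_x D(x)f(x)^2\ge0$ for every polynomial $f$ of degree at most $t/2$; its pseudo-expectation is $\tilde{\mathbb E}_D f=\sum_x D(x)f(x)$ (entrywise for vector/matrix-valued $f$). $D$ satisfies a system $\{f_1\ge0,\ldots,f_m\ge0\}$ at degree $\ell$ if $\tilde{\mathbb E}_D(\prod_{i\in S}f_i)h\ge0$ for every $S\subseteq[m]$ and every sum-of-squares polynomial $h$ with $|S|\ell+\deg h\le t$; "satisfies" without a degree means $\ell$ is the maximum degree of the $f_i$. $O(\cdot)$ hides absolute constants.
   Formalization: If the pseudo-expectation of uu^T is zero (e.g. D a point mass at 0), M_g = 0 and "the top eigenvector" is not determined; there the conclusion only says that some top eigenvector satisfies the bound. In all other cases it holds for every top eigenvector. *)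

theory Defs
  imports
    "HOL-Probability.Probability"
    "HOL-Library.Poly_Mapping"
    "Jordan_Normal_Form.Char_Poly"
begin

text \<open>The dimension \<open>d\<close> is a natural number rather than a type, so that absolute constants can be
  quantified before it: \<open>\<real>\<^sup>d\<close> is \<open>carrier_vec d\<close>.\<close>

unbundle no vec_syntax
hide_type (open) Finite_Cartesian_Product.vec
hide_const (open) Finite_Cartesian_Product.mat Finite_Cartesian_Product.vec

text \<open>A polynomial is a finitely supported map from exponent vectors to coefficients; its ring
  structure is the convolution structure of \<^theory>\<open>HOL-Library.Poly_Mapping\<close>.\<close>

type_synonym mpoly = "(nat \<Rightarrow>\<^sub>0 nat) \<Rightarrow>\<^sub>0 real"

definition mvar :: "nat \<Rightarrow> mpoly" where
  "mvar i = Poly_Mapping.single (Poly_Mapping.single i 1) 1"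

definition mpolys :: "nat \<Rightarrow> mpoly set" where
  "mpolys d = {p. \<forall>m \<in> Poly_Mapping.keys p. Poly_Mapping.keys m \<subseteq> {..<d}}"

definition monom_degree :: "(nat \<Rightarrow>\<^sub>0 nat) \<Rightarrow> nat" where
  "monom_degree m = (\<Sum>i \<in> Poly_Mapping.keys m. Poly_Mapping.lookup m i)"

text \<open>Total degree; the zero polynomial gets degree \<open>0\<close>.\<close>

definition mpoly_degree :: "mpoly \<Rightarrow> nat" where
  "mpoly_degree p = Max (insert 0 (monom_degree ` Poly_Mapping.keys p))"

definition mpoly_eval :: "mpoly \<Rightarrow> real vec \<Rightarrow> real" where
  "mpoly_eval p x = (\<Sum>m \<in> Poly_Mapping.keys p. Poly_Mapping.lookup p m *
     (\<Prod>i \<in> Poly_Mapping.keys m. (x $ i) ^ Poly_Mapping.lookup m i))"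

definition sum_of_squares :: "nat \<Rightarrow> mpoly \<Rightarrow> bool" where
  "sum_of_squares d h \<longleftrightarrow> (\<exists>ps. set ps \<subseteq> mpolys d \<and> h = (\<Sum>p\<leftarrow>ps. p ^ 2))"

definition pseudo_expectation :: "(real vec \<Rightarrow> real) \<Rightarrow> (real vec \<Rightarrow> real) \<Rightarrow> real" where
  "pseudo_expectation D f = (\<Sum>x | D x \<noteq> 0. D x * f x)"

definition pseudo_expectation_mat ::
  "nat \<Rightarrow> (real vec \<Rightarrow> real) \<Rightarrow> (real vec \<Rightarrow> real mat) \<Rightarrow> real mat" where
  "pseudo_expectation_mat d D F = mat d d (\<lambda>(i, j). pseudo_expectation D (\<lambda>x. F x $$ (i, j)))"

definition pseudo_distribution :: "nat \<Rightarrow> nat \<Rightarrow> (real vec \<Rightarrow> real) \<Rightarrow> bool" where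
  "pseudo_distribution d t D \<longleftrightarrow>
     finite {x. D x \<noteq> 0} \<and> {x. D x \<noteq> 0} \<subseteq> carrier_vec d \<and>
     (\<Sum>x | D x \<noteq> 0. D x) = 1 \<and>
     (\<forall>f \<in> mpolys d. 2 * mpoly_degree f \<le> t \<longrightarrow>
        pseudo_expectation D (\<lambda>x. (mpoly_eval f x) ^ 2) \<ge> 0)"

text \<open>The list \<open>fs\<close> stands for the system of constraints \<open>f \<ge> 0\<close>, one for each entry \<open>f\<close>;
  \<open>t\<close> is the degree of the pseudo-distribution and \<open>l\<close> the degree at which the system is
  satisfied.\<close>

definition satisfies_at ::
  "nat \<Rightarrow> nat \<Rightarrow> (real vec \<Rightarrow> real) \<Rightarrow> nat \<Rightarrow> mpoly list \<Rightarrow> bool" where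
  "satisfies_at d t D l fs \<longleftrightarrow>
     (\<forall>S \<subseteq> {..<length fs}. \<forall>h. sum_of_squares d h \<and> card S * l + mpoly_degree h \<le> t \<longrightarrow>
        pseudo_expectation D (\<lambda>x. (\<Prod>i\<in>S. mpoly_eval (fs ! i) x) * mpoly_eval h x) \<ge> 0)"

definition satisfies :: "nat \<Rightarrow> nat \<Rightarrow> (real vec \<Rightarrow> real) \<Rightarrow> mpoly list \<Rightarrow> bool" where
  "satisfies d t D fs \<longleftrightarrow> satisfies_at d t D (Max (insert 0 (mpoly_degree ` set fs))) fs"

definition unit_ball_constraint :: "nat \<Rightarrow> mpoly" where
  "unit_ball_constraint d = 1 - (\<Sum>i<d. mvar i ^ 2)"

definition vnorm :: "real vec \<Rightarrow> real" where
  "vnorm v = sqrt (scalar_prod v v)"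

definition spectral_norm :: "real mat \<Rightarrow> real" where
  "spectral_norm A = Sup {vnorm (A *\<^sub>v v) | v. v \<in> carrier_vec (dim_col A) \<and> vnorm v \<le> 1}"

definition outer_self :: "real vec \<Rightarrow> real mat" where
  "outer_self u = mat (dim_vec u) (dim_vec u) (\<lambda>(i, j). u $ i * u $ j)"

definition top_eigenvector :: "real mat \<Rightarrow> real vec \<Rightarrow> bool" where
  "top_eigenvector A v \<longleftrightarrow> vnorm v = 1 \<and>
     (\<exists>l. eigenvector A v l \<and> (\<forall>m. eigenvalue A m \<longrightarrow> m \<le> l))"

text \<open>Tensors of order \<open>k\<close> over \<open>\<real>\<^sup>d\<close> are families of reals indexed by maps from \<open>{..<k}\<close> to
  \<open>{..<d}\<close>.\<close>

definition tensor_index :: "nat \<Rightarrow> nat \<Rightarrow> (nat \<Rightarrow> nat) set" where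
  "tensor_index d k = {..<k} \<rightarrow>\<^sub>E {..<d}"

definition tensor_power :: "nat \<Rightarrow> real vec \<Rightarrow> (nat \<Rightarrow> nat) \<Rightarrow> real" where
  "tensor_power k u = (\<lambda>\<alpha>. \<Prod>j<k. u $ \<alpha> j)"

definition tensor_inner ::
  "nat \<Rightarrow> nat \<Rightarrow> ((nat \<Rightarrow> nat) \<Rightarrow> real) \<Rightarrow> ((nat \<Rightarrow> nat) \<Rightarrow> real) \<Rightarrow> real" where
  "tensor_inner d k S T = (\<Sum>\<alpha> \<in> tensor_index d k. S \<alpha> * T \<alpha>)"

definition gaussian_tensor :: "nat \<Rightarrow> nat \<Rightarrow> ((nat \<Rightarrow> nat) \<Rightarrow> real) measure" where
  "gaussian_tensor d k = Pi\<^sub>M (tensor_index d k) (\<lambda>_. std_normal_distribution)"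

definition second_moment :: "nat \<Rightarrow> (real vec \<Rightarrow> real) \<Rightarrow> real mat" where
  "second_moment d D = pseudo_expectation_mat d D outer_self"

definition contracted_moment ::
  "nat \<Rightarrow> nat \<Rightarrow> (real vec \<Rightarrow> real) \<Rightarrow> ((nat \<Rightarrow> nat) \<Rightarrow> real) \<Rightarrow> real mat" where
  "contracted_moment d k D g =
     pseudo_expectation_mat d D (\<lambda>u. tensor_inner d k g (tensor_power k u) \<cdot>\<^sub>m outer_self u)"

end

theory Submission
  imports Defs
begin

text \<open>Write \<open>E\<close> for the pseudo-expectation, \<open>\<sigma>\<close> for the norm of the second moment matrix, and
  \<open>M\<^sub>g = \<Sum>\<^sub>\<alpha> g\<^sub>\<alpha> A\<^sub>\<alpha>\<close> with \<open>A\<^sub>\<alpha> = E u\<^sub>\<alpha> u u\<^sup>T\<close>. Shifting \<open>g\<close> by \<open>\<tau> a\<^sup>\<otimes>\<^sup>k\<close> adds \<open>\<tau> E \<langle>a, u\<rangle>\<^sup>k u u\<^sup>T\<close> to \<open>M\<^sub>g\<close>, and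
  for \<open>\<tau>\<^sup>2 = k ln d\<close> the Gaussian density changes by a factor \<open>d\<^sup>-\<^sup>O\<^sup>(\<^sup>k\<^sup>)\<close> only, where \<open>\<langle>a\<^sup>\<otimes>\<^sup>k, g\<rangle>\<close> is bounded. So it
  suffices that with probability at least \<open>1/2\<close> the noise \<open>M\<^sub>g\<close> is dominated by the shift.

  Noise: sum-of-squares Cauchy-Schwarz gives \<open>\<Sum>\<^sub>\<alpha> A\<^sub>\<alpha>\<^sup>2 \<le> \<sigma>\<^sup>2\<close>, and Gaussian integration by parts bounds
  the mean of \<open>tr M\<^sub>g\<^sup>2\<^sup>p\<close> by \<open>d (2 p \<sigma>\<^sup>2)\<^sup>p\<close>; Markov's inequality with \<open>p\<close> of order \<open>ln d\<close> yields \<open>|M\<^sub>g| \<le> O(\<sigma> (ln d)\<^sup>1\<^sup>/\<^sup>2)\<close>.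

  Signal: convexity of the moments \<open>E \<langle>a, u\<rangle>\<^sup>2\<^sup>j\<close> shows that \<open>E \<langle>a, u\<rangle>\<^sup>k u u\<^sup>T\<close> is at most \<open>2 \<sigma> / k\<close> on the
  complement of \<open>a\<close>, while its value at \<open>a\<close> is at least \<open>C \<sigma> / (\<epsilon> k\<^sup>1\<^sup>/\<^sup>2)\<close>.\<close>

section \<open>Polynomial functions and sums of squares\<close>

definition monom_eval :: "(nat \<Rightarrow>\<^sub>0 nat) \<Rightarrow> real vec \<Rightarrow> real" where
  "monom_eval m x = (\<Prod>i \<in> Poly_Mapping.keys m. (x $ i) ^ Poly_Mapping.lookup m i)"

lemma monom_eval_superset:
  assumes "finite S" "Poly_Mapping.keys m \<subseteq> S"
  shows "monom_eval m x = (\<Prod>i \<in> S. (x $ i) ^ Poly_Mapping.lookup m i)"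
  unfolding monom_eval_def
  by (rule prod.mono_neutral_left[OF assms]) (auto simp: in_keys_iff)

lemma monom_eval_add: "monom_eval (m + n) x = monom_eval m x * monom_eval n x"
proof -
  let ?S = "Poly_Mapping.keys m \<union> Poly_Mapping.keys n"
  have "Poly_Mapping.keys (m + n) \<subseteq> ?S" by (rule Poly_Mapping.keys_add)
  then show ?thesis
    by (simp add: monom_eval_superset[of ?S] lookup_add power_add prod.distrib)
qed

lemma monom_degree_superset:
  assumes "finite S" "Poly_Mapping.keys m \<subseteq> S"
  shows "monom_degree m = (\<Sum>i \<in> S. Poly_Mapping.lookup m i)"
  unfolding monom_degree_def
  by (rule sum.mono_neutral_left[OF assms]) (auto simp: in_keys_iff)

lemma monom_degree_add: "monom_degree (m + n) = monom_degree m + monom_degree n"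
proof -
  let ?S = "Poly_Mapping.keys m \<union> Poly_Mapping.keys n"
  have "Poly_Mapping.keys (m + n) \<subseteq> ?S" by (rule Poly_Mapping.keys_add)
  then show ?thesis
    by (simp add: monom_degree_superset[of ?S] lookup_add sum.distrib)
qed

lemma mpoly_eval_superset:
  assumes "finite S" "Poly_Mapping.keys p \<subseteq> S"
  shows "mpoly_eval p x = (\<Sum>m \<in> S. Poly_Mapping.lookup p m * monom_eval m x)"
  unfolding mpoly_eval_def monom_eval_def
  by (rule sum.mono_neutral_left[OF assms]) (auto simp: in_keys_iff)

lemma mpoly_eval_add: "mpoly_eval (p + q) x = mpoly_eval p x + mpoly_eval q x"
proof -
  let ?S = "Poly_Mapping.keys p \<union> Poly_Mapping.keys q"
  have "Poly_Mapping.keys (p + q) \<subseteq> ?S" by (rule Poly_Mapping.keys_add)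
  then show ?thesis
    by (simp add: mpoly_eval_superset[of ?S] lookup_add algebra_simps sum.distrib)
qed

lemma mpoly_eval_zero [simp]: "mpoly_eval 0 x = 0"
  by (simp add: mpoly_eval_def)

lemma mpoly_eval_sum: "mpoly_eval (\<Sum>i\<in>I. p i) x = (\<Sum>i\<in>I. mpoly_eval (p i) x)"
  by (induction I rule: infinite_finite_induct) (simp_all add: mpoly_eval_add)

lemma mpoly_eval_single [simp]: "mpoly_eval (Poly_Mapping.single m c) x = c * monom_eval m x"
  by (simp add: mpoly_eval_superset[of "{m}"])

lemma mpoly_as_sum: "p = (\<Sum>m\<in>Poly_Mapping.keys p. Poly_Mapping.single m (Poly_Mapping.lookup p m))"
  by (rule poly_mapping_eqI) (auto simp: lookup_sum lookup_single when_def in_keys_iff)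

text \<open>Splitting both factors into single terms avoids unfolding the convolution: on single
  terms multiplication adds exponents, and \<open>monom_eval_add\<close> applies.\<close>

lemma mpoly_eval_mult: "mpoly_eval (p * q) x = mpoly_eval p x * mpoly_eval (q :: mpoly) x"
proof -
  let ?s = "\<lambda>p m. Poly_Mapping.single m (Poly_Mapping.lookup p m)"
  have "p * q = (\<Sum>m\<in>Poly_Mapping.keys p. ?s p m) * (\<Sum>n\<in>Poly_Mapping.keys q. ?s q n)"
    by (simp only: mpoly_as_sum[symmetric])
  also have "\<dots> = (\<Sum>m\<in>Poly_Mapping.keys p. \<Sum>n\<in>Poly_Mapping.keys q.
      Poly_Mapping.single (m + n) (Poly_Mapping.lookup p m * Poly_Mapping.lookup q n))"
    by (simp add: sum_product mult_single)
  finally have "mpoly_eval (p * q) x = (\<Sum>m\<in>Poly_Mapping.keys p. \<Sum>n\<in>Poly_Mapping.keys q.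
      (Poly_Mapping.lookup p m * monom_eval m x) * (Poly_Mapping.lookup q n * monom_eval n x))"
    by (simp add: mpoly_eval_sum monom_eval_add mult_ac)
  then show ?thesis
    by (simp add: sum_product mpoly_eval_superset[of "Poly_Mapping.keys p"]
        mpoly_eval_superset[of "Poly_Mapping.keys q" q])
qed

section \<open>Degree bounds for polynomials\<close>

lemma mpoly_degree_le_iff:
  "mpoly_degree p \<le> s \<longleftrightarrow> (\<forall>m\<in>Poly_Mapping.keys p. monom_degree m \<le> s)"
  by (auto simp: mpoly_degree_def)

definition mpolys_le :: "nat \<Rightarrow> nat \<Rightarrow> mpoly set" where
  "mpolys_le d s = {p \<in> mpolys d. mpoly_degree p \<le> s}"

lemma mpolys_le_iff:
  "p \<in> mpolys_le d s \<longleftrightarrow>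
     (\<forall>m\<in>Poly_Mapping.keys p. Poly_Mapping.keys m \<subseteq> {..<d} \<and> monom_degree m \<le> s)"
  by (auto simp: mpolys_le_def mpolys_def mpoly_degree_le_iff)

lemma mpolys_le_add: "p \<in> mpolys_le d s \<Longrightarrow> q \<in> mpolys_le d s \<Longrightarrow> p + q \<in> mpolys_le d s"
  using Poly_Mapping.keys_add[of p q] unfolding mpolys_le_iff by blast

lemma mpolys_le_mult:
  assumes "p \<in> mpolys_le d s" "q \<in> mpolys_le d r"
  shows "p * q \<in> mpolys_le d (s + r)"
  unfolding mpolys_le_iff
proof
  fix l assume "l \<in> Poly_Mapping.keys (p * q)"
  then obtain m n where l: "l = m + n" and mn: "m \<in> Poly_Mapping.keys p" "n \<in> Poly_Mapping.keys q"
    using keys_mult[of p q] by blast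
  have "Poly_Mapping.keys l \<subseteq> Poly_Mapping.keys m \<union> Poly_Mapping.keys n"
    unfolding l by (rule Poly_Mapping.keys_add)
  then show "Poly_Mapping.keys l \<subseteq> {..<d} \<and> monom_degree l \<le> s + r"
    using assms mn unfolding mpolys_le_iff l monom_degree_add by (meson Un_least add_mono subset_trans)
qed

lemma mpolys_le_mono: "p \<in> mpolys_le d s \<Longrightarrow> s \<le> r \<Longrightarrow> p \<in> mpolys_le d r"
  by (auto simp: mpolys_le_def)

lemma mpolys_le_const: "Poly_Mapping.single 0 c \<in> mpolys_le d s"
  by (auto simp: mpolys_le_iff monom_degree_def)

lemma mpolys_le_var: "i < d \<Longrightarrow> mvar i \<in> mpolys_le d (Suc s)"
  by (auto simp: mpolys_le_iff monom_degree_def mvar_def)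

lemma mpolys_le_sum: "(\<And>i. i \<in> I \<Longrightarrow> p i \<in> mpolys_le d s) \<Longrightarrow> (\<Sum>i\<in>I. p i) \<in> mpolys_le d s"
  by (induction I rule: infinite_finite_induct)
    (auto intro: mpolys_le_add simp: mpolys_le_iff[of 0])

lemma monom_eval_zero [simp]: "monom_eval 0 x = 1"
  by (simp add: monom_eval_def)

lemma mpoly_eval_one [simp]: "mpoly_eval 1 x = 1"
  using mpoly_eval_single[of 0 1 x] by (simp del: mpoly_eval_single)

lemma mpoly_eval_var [simp]: "mpoly_eval (mvar i) x = x $ i"
  by (simp add: mvar_def monom_eval_def)

lemma mpoly_eval_square [simp]: "mpoly_eval (p\<^sup>2) x = (mpoly_eval p x)\<^sup>2"
  by (simp add: power2_eq_square mpoly_eval_mult)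

text \<open>Pseudo-expectations see only functions, so the inequalities below are proved for
  functions with a degree bound; identities between them are then plain real arithmetic.\<close>

definition polyfun :: "nat \<Rightarrow> nat \<Rightarrow> (real vec \<Rightarrow> real) \<Rightarrow> bool" where
  "polyfun d s f \<longleftrightarrow> (\<exists>p \<in> mpolys_le d s. f = mpoly_eval p)"

lemma polyfunI: "p \<in> mpolys_le d s \<Longrightarrow> (\<And>x. f x = mpoly_eval p x) \<Longrightarrow> polyfun d s f"
  by (auto simp: polyfun_def)

lemma polyfun_const: "polyfun d s (\<lambda>_. c)"
  by (rule polyfunI[OF mpolys_le_const[of c]]) simp

lemma polyfun_coord: "i < d \<Longrightarrow> polyfun d (Suc s) (\<lambda>u. u $ i)"
  by (rule polyfunI[OF mpolys_le_var]) simp_all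

lemma polyfun_add: "polyfun d s f \<Longrightarrow> polyfun d s g \<Longrightarrow> polyfun d s (\<lambda>u. f u + g u)"
  unfolding polyfun_def by (force intro!: bexI[OF _ mpolys_le_add] simp: mpoly_eval_add)

lemma polyfun_mult: "polyfun d s f \<Longrightarrow> polyfun d r g \<Longrightarrow> polyfun d (s + r) (\<lambda>u. f u * g u)"
  unfolding polyfun_def by (force intro!: bexI[OF _ mpolys_le_mult] simp: mpoly_eval_mult)

lemma polyfun_mono: "polyfun d s f \<Longrightarrow> s \<le> r \<Longrightarrow> polyfun d r f"
  unfolding polyfun_def using mpolys_le_mono by blast

lemma polyfun_cmult: "polyfun d s f \<Longrightarrow> polyfun d s (\<lambda>u. c * f u)"
  using polyfun_mult[OF polyfun_const[of d 0 c], of s f] by simp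

lemma polyfun_diff: "polyfun d s f \<Longrightarrow> polyfun d s g \<Longrightarrow> polyfun d s (\<lambda>u. f u - g u)"
  using polyfun_add[OF _ polyfun_cmult[of d s g "-1"], of f] by simp

lemma polyfun_sum:
  "(\<And>i. i \<in> I \<Longrightarrow> polyfun d s (f i)) \<Longrightarrow> polyfun d s (\<lambda>u. \<Sum>i\<in>I. f i u)"
  by (induction I rule: infinite_finite_induct) (auto intro: polyfun_add polyfun_const)

lemma polyfun_prod_lessThan:
  "(\<And>j. j < n \<Longrightarrow> polyfun d 1 (f j)) \<Longrightarrow> polyfun d n (\<lambda>u. \<Prod>j<n. f j u)"
proof (induction n)
  case (Suc n)
  then have "polyfun d (n + 1) (\<lambda>u. (\<Prod>j<n. f j u) * f n u)"
    by (intro polyfun_mult) auto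
  then show ?case by simp
qed (simp add: polyfun_const)

lemma polyfun_power: "polyfun d 1 f \<Longrightarrow> polyfun d n (\<lambda>u. f u ^ n)"
  using polyfun_prod_lessThan[of n d "\<lambda>_. f"] by simp

text \<open>The bound \<open>s\<close> is on the degree of each squared function, so a member has
  degree up to \<open>2 * s\<close>. The inductive form replaces lists of polynomials by rule
  induction.\<close>

inductive sosfun :: "nat \<Rightarrow> nat \<Rightarrow> (real vec \<Rightarrow> real) \<Rightarrow> bool" for d s where
  zero: "sosfun d s (\<lambda>_. 0)"
| add_square: "polyfun d s f \<Longrightarrow> sosfun d s g \<Longrightarrow> sosfun d s (\<lambda>u. (f u)\<^sup>2 + g u)"

lemma sosfun_square: "polyfun d s f \<Longrightarrow> sosfun d s (\<lambda>u. (f u)\<^sup>2)"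
  using sosfun.add_square[OF _ sosfun.zero, of d s f] by simp

lemma sosfun_add: "sosfun d s f \<Longrightarrow> sosfun d s g \<Longrightarrow> sosfun d s (\<lambda>u. f u + g u)"
proof (induction rule: sosfun.induct)
  case (add_square h f)
  then show ?case using sosfun.add_square[of d s h "\<lambda>u. f u + g u"] by (simp add: add.assoc)
qed simp

lemma sosfun_sum: "(\<And>i. i \<in> I \<Longrightarrow> sosfun d s (f i)) \<Longrightarrow> sosfun d s (\<lambda>u. \<Sum>i\<in>I. f i u)"
  by (induction I rule: infinite_finite_induct) (auto intro: sosfun_add sosfun.zero)

lemma sosfun_mult_square:
  assumes f: "polyfun d r f" shows "sosfun d s g \<Longrightarrow> sosfun d (r + s) (\<lambda>u. (f u)\<^sup>2 * g u)"
proof (induction rule: sosfun.induct)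
  case (add_square h g)
  then show ?case
    using sosfun.add_square[OF polyfun_mult[OF f, of s h], of "\<lambda>u. (f u)\<^sup>2 * g u"]
    by (simp add: algebra_simps power_mult_distrib)
qed (simp add: sosfun.zero)

lemma sosfun_mult:
  assumes g: "sosfun d s g" shows "sosfun d r f \<Longrightarrow> sosfun d (r + s) (\<lambda>u. f u * g u)"
proof (induction rule: sosfun.induct)
  case (add_square h f)
  then show ?case
    using sosfun_add[OF sosfun_mult_square[OF add_square(1) g] add_square.IH]
    by (simp add: algebra_simps)
qed (simp add: sosfun.zero)

lemma sosfun_cmult:
  assumes "0 \<le> c" "sosfun d s f" shows "sosfun d s (\<lambda>u. c * f u)"
  using sosfun_mult_square[OF polyfun_const[of d 0 "sqrt c"] assms(2)] assms(1) by simp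

lemma sosfun_even_power: "polyfun d 1 f \<Longrightarrow> even k \<Longrightarrow> sosfun d (k div 2) (\<lambda>u. f u ^ k)"
  using sosfun_square[OF polyfun_power[of d f "k div 2"]]
  by (simp flip: power_mult)

text \<open>The way back to formal polynomials, over which the definition of
  \<open>satisfies\<close> quantifies. Summands of degree at most \<open>2 * s\<close> keep the sum
  within that degree, whatever cancels.\<close>

lemma sosfun_representation:
  assumes "sosfun d s f"
  shows "\<exists>h. sum_of_squares d h \<and> mpoly_degree h \<le> 2 * s \<and> f = mpoly_eval h"
proof -
  have "\<exists>ps. set ps \<subseteq> mpolys_le d s \<and> f = mpoly_eval (\<Sum>p\<leftarrow>ps. p\<^sup>2)"
    using assms
  proof (induction rule: sosfun.induct)
    case zero
    show ?case by (rule exI[of _ "[]"]) auto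
  next
    case (add_square h g)
    then obtain p ps where "p \<in> mpolys_le d s" "h = mpoly_eval p"
      "set ps \<subseteq> mpolys_le d s" "g = mpoly_eval (\<Sum>p\<leftarrow>ps. p\<^sup>2)"
      unfolding polyfun_def by blast
    then show ?case by (intro exI[of _ "p # ps"]) (auto simp: mpoly_eval_add)
  qed
  then obtain ps where ps: "set ps \<subseteq> mpolys_le d s" "f = mpoly_eval (\<Sum>p\<leftarrow>ps. p\<^sup>2)"
    by blast
  have "(\<Sum>p\<leftarrow>ps. p\<^sup>2) \<in> mpolys_le d (2 * s)"
    using ps(1)
  proof (induction ps)
    case (Cons p ps)
    then show ?case using mpolys_le_mult[of p d s p s]
      by (auto simp: power2_eq_square mult_2 intro!: mpolys_le_add)
  qed (simp add: mpolys_le_iff)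
  moreover have "sum_of_squares d (\<Sum>p\<leftarrow>ps. p\<^sup>2)"
    unfolding sum_of_squares_def using ps(1) by (auto simp: mpolys_le_def)
  ultimately show ?thesis using ps(2) by (auto simp: mpolys_le_def)
qed

section \<open>Inequalities for pseudo-expectations\<close>

text \<open>The defect in the Cauchy-Schwarz inequality is here an explicit sum of squares, which is
  what carries the inequality over to pseudo-expectations.\<close>

lemma lagrange_identity:
  fixes F G :: "'a \<Rightarrow> real"
  shows "(\<Sum>i\<in>I. (F i)\<^sup>2) * (\<Sum>i\<in>I. (G i)\<^sup>2) - (\<Sum>i\<in>I. F i * G i)\<^sup>2
       = (\<Sum>i\<in>I. \<Sum>j\<in>I. (1/2) * (F i * G j - F j * G i)\<^sup>2)"
proof -
  have "(\<Sum>i\<in>I. \<Sum>j\<in>I. (1/2) * (F i * G j - F j * G i)\<^sup>2)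
     = (\<Sum>i\<in>I. \<Sum>j\<in>I. (1/2) * ((F i)\<^sup>2 * (G j)\<^sup>2) + (1/2) * ((F j)\<^sup>2 * (G i)\<^sup>2)
          - (F i * G i) * (F j * G j))"
    by (intro sum.cong refl) (simp add: power2_eq_square algebra_simps)
  also have "\<dots> = (1/2) * (\<Sum>i\<in>I. \<Sum>j\<in>I. (F i)\<^sup>2 * (G j)\<^sup>2)
      + (1/2) * (\<Sum>i\<in>I. \<Sum>j\<in>I. (F j)\<^sup>2 * (G i)\<^sup>2) - (\<Sum>i\<in>I. \<Sum>j\<in>I. (F i * G i) * (F j * G j))"
    by (simp add: sum.distrib sum_subtractf sum_distrib_left)
  also have "(\<Sum>i\<in>I. \<Sum>j\<in>I. (F j)\<^sup>2 * (G i)\<^sup>2) = (\<Sum>i\<in>I. \<Sum>j\<in>I. (F i)\<^sup>2 * (G j)\<^sup>2)"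
    by (rule sum.swap)
  finally show ?thesis by (simp add: sum_product power2_eq_square)
qed

section \<open>Pseudo-expectations under the unit ball constraint\<close>

abbreviation lin :: "nat \<Rightarrow> (nat \<Rightarrow> real) \<Rightarrow> real vec \<Rightarrow> real" where
  "lin d x u \<equiv> (\<Sum>i<d. x i * u $ i)"

abbreviation normsq :: "nat \<Rightarrow> (nat \<Rightarrow> real) \<Rightarrow> real" where
  "normsq d x \<equiv> (\<Sum>i<d. (x i)\<^sup>2)"

locale ball_pseudo_distribution =
  fixes d t :: nat and D :: "real vec \<Rightarrow> real"
  assumes pd: "pseudo_distribution d t D"
    and ball: "satisfies d t D [unit_ball_constraint d]"
begin

abbreviation E where "E \<equiv> pseudo_expectation D"
abbreviation nsq :: "real vec \<Rightarrow> real" where "nsq u \<equiv> (\<Sum>i<d. (u $ i)\<^sup>2)"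

lemma support_carrier: "D x \<noteq> 0 \<Longrightarrow> x \<in> carrier_vec d"
  using pd by (auto simp: pseudo_distribution_def)

lemma E_add: "E (\<lambda>u. f u + g u) = E f + E g"
  by (simp add: pseudo_expectation_def algebra_simps sum.distrib)

lemma E_diff: "E (\<lambda>u. f u - g u) = E f - E g"
  by (simp add: pseudo_expectation_def algebra_simps sum_subtractf)

lemma E_cmult: "E (\<lambda>u. c * f u) = c * E f"
  by (simp add: pseudo_expectation_def sum_distrib_left mult_ac)

lemma E_sum: "E (\<lambda>u. \<Sum>i\<in>I. f i u) = (\<Sum>i\<in>I. E (f i))"
  by (simp add: pseudo_expectation_def sum_distrib_left sum.swap[of _ I])

lemma E_cong: "(\<And>u. u \<in> carrier_vec d \<Longrightarrow> f u = g u) \<Longrightarrow> E f = E g"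
  unfolding pseudo_expectation_def by (rule sum.cong) (auto simp: support_carrier)

lemma eval_ball: "mpoly_eval (unit_ball_constraint d) u = 1 - nsq u"
proof -
  have "unit_ball_constraint d = 1 + (\<Sum>i<d. Poly_Mapping.single 0 (-1) * mvar i ^ 2)"
    by (simp add: unit_ball_constraint_def single_uminus sum_negf)
  then show ?thesis
    by (simp add: mpoly_eval_add mpoly_eval_sum mpoly_eval_mult sum_negf)
qed

text \<open>Stated as an inequality because for \<open>d = 0\<close> the constraint is the constant
  1.\<close>

lemma degree_ball: "mpoly_degree (unit_ball_constraint d) \<le> 2"
proof -
  have "1 + (\<Sum>i<d. Poly_Mapping.single 0 (-1) * mvar i ^ 2) \<in> mpolys_le d 2"
  proof (intro mpolys_le_add mpolys_le_sum)
    show "1 \<in> mpolys_le d 2" using mpolys_le_const[of 1] by simp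
    fix i assume "i \<in> {..<d}"
    then have "mvar i \<in> mpolys_le d 1" using mpolys_le_var[of i d 0] by simp
    from mpolys_le_mult[OF mpolys_le_const[of "-1" d 0] mpolys_le_mult[OF this this]]
    show "Poly_Mapping.single 0 (-1) * mvar i ^ 2 \<in> mpolys_le d 2"
      by (simp add: power2_eq_square numeral_2_eq_2)
  qed
  then show ?thesis
    by (simp add: unit_ball_constraint_def single_uminus mpolys_le_def sum_negf)
qed

lemma E_sos:
  assumes "sosfun d s f" "2 * s \<le> t" shows "0 \<le> E f"
proof -
  obtain h where h: "sum_of_squares d h" "mpoly_degree h \<le> 2 * s" "f = mpoly_eval h"
    using sosfun_representation[OF assms(1)] by blast
  \<comment> \<open>The empty set of constraints uses up no degree.\<close>
  have "0 \<le> E (\<lambda>x. (\<Prod>i\<in>{}. mpoly_eval ([unit_ball_constraint d] ! i) x) * mpoly_eval h x)"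
    using ball h assms(2) unfolding satisfies_def satisfies_at_def
    by (elim allE[of _ "{}"]) auto
  then show ?thesis by (simp add: h)
qed

lemma E_ball_sos:
  assumes "sosfun d s f" "2 * s + 2 \<le> t" shows "E (\<lambda>u. nsq u * f u) \<le> E f"
proof -
  obtain h where h: "sum_of_squares d h" "mpoly_degree h \<le> 2 * s" "f = mpoly_eval h"
    using sosfun_representation[OF assms(1)] by blast
  \<comment> \<open>The singleton set of constraints uses up degree at most 2, whence the
    \<open>+ 2\<close> in the hypothesis.\<close>
  have "0 \<le> E (\<lambda>x. (\<Prod>i\<in>{0}. mpoly_eval ([unit_ball_constraint d] ! i) x) * mpoly_eval h x)"
    using ball h assms(2) degree_ball unfolding satisfies_def satisfies_at_def
    by (elim allE[of _ "{0}"]) auto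
  then have "0 \<le> E (\<lambda>x. f x - nsq x * f x)" by (simp add: h eval_ball algebra_simps)
  then show ?thesis by (simp add: E_diff)
qed

lemma polyfun_lin: "polyfun d 1 (lin d x)"
  by (intro polyfun_sum polyfun_cmult) (use polyfun_coord[of _ d 0] in auto)

lemma sosfun_nsq: "sosfun d 1 nsq"
  by (intro sosfun_sum sosfun_square) (use polyfun_coord[of _ d 0] in auto)

text \<open>Each factor \<open>nsq u\<close> is absorbed into the sum of squares in turn, so
  \<open>f\<close> and \<open>s\<close> are generalised in the induction.\<close>

lemma E_ball_power_sos:
  assumes "sosfun d s f" "2 * s + 2 * n \<le> t" shows "E (\<lambda>u. nsq u ^ n * f u) \<le> E f"
  using assms
proof (induction n arbitrary: s f)
  case (Suc n)
  have "sosfun d (1 + s) (\<lambda>u. nsq u * f u)" by (rule sosfun_mult[OF Suc.prems(1) sosfun_nsq])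
  from Suc.IH[OF this] Suc.prems(2) have "E (\<lambda>u. nsq u ^ n * (nsq u * f u)) \<le> E (\<lambda>u. nsq u * f u)"
    by simp
  also have "\<dots> \<le> E f" using E_ball_sos[OF Suc.prems(1)] Suc.prems(2) by simp
  finally show ?case by (simp add: mult_ac)
qed simp

text \<open>The difference of the two integrands is the Lagrange defect times \<open>h\<close>,
  again a sum of squares.\<close>

lemma E_cauchy_schwarz:
  assumes "\<And>i. i \<in> I \<Longrightarrow> polyfun d s (F i)" "\<And>i. i \<in> I \<Longrightarrow> polyfun d r (G i)" "sosfun d q h"
    and deg: "2 * (s + r + q) \<le> t"
  shows "E (\<lambda>u. (\<Sum>i\<in>I. F i u * G i u)\<^sup>2 * h u)
       \<le> E (\<lambda>u. (\<Sum>i\<in>I. (F i u)\<^sup>2) * (\<Sum>i\<in>I. (G i u)\<^sup>2) * h u)"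
proof -
  have "sosfun d (s + r + q) (\<lambda>u. (\<Sum>i\<in>I. \<Sum>j\<in>I. (1/2) * (F i u * G j u - F j u * G i u)\<^sup>2) * h u)"
    using assms(1-3)
    by (intro sosfun_mult sosfun_sum sosfun_cmult sosfun_square polyfun_diff polyfun_mult) auto
  from E_sos[OF this deg] show ?thesis
    by (simp only: lagrange_identity[symmetric] left_diff_distrib E_diff diff_ge_0_iff_ge)
qed

text \<open>The entries of the matrices \<open>A\<^sub>\<alpha>\<close>: the coefficient of
  \<open>g \<alpha>\<close> in \<open>contracted_moment d k D g\<close>.\<close>

definition tensor_moment :: "nat \<Rightarrow> (nat \<Rightarrow> nat) \<Rightarrow> nat \<Rightarrow> nat \<Rightarrow> real" where
  "tensor_moment k \<alpha> i j = E (\<lambda>u. tensor_power k u \<alpha> * (u $ i * u $ j))"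

lemma polyfun_tensor_power:
  "\<alpha> \<in> tensor_index d k \<Longrightarrow> polyfun d k (\<lambda>u. tensor_power k u \<alpha>)"
  unfolding tensor_power_def tensor_index_def
  by (intro polyfun_prod_lessThan) (use polyfun_coord[of _ d 0] in \<open>auto dest!: PiE_mem\<close>)

lemma finite_tensor_index: "finite (tensor_index d k)"
  unfolding tensor_index_def by (rule finite_PiE) auto

lemma tensor_power_normsq: "(\<Sum>\<alpha>\<in>tensor_index d k. (tensor_power k u \<alpha>)\<^sup>2) = nsq u ^ k"
proof -
  have "(\<Prod>j\<in>{..<k}. \<Sum>i\<in>{..<d}. (u $ i)\<^sup>2) = (\<Sum>p\<in>{..<k} \<rightarrow>\<^sub>E {..<d}. \<Prod>j\<in>{..<k}. (u $ p j)\<^sup>2)"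
    by (rule prod_sum_PiE) auto
  then show ?thesis
    by (simp add: tensor_index_def tensor_power_def prod_power_distrib)
qed

end

text \<open>Here \<open>\<sigma>\<close> is any positive bound and not fixed as the spectral norm,
  since the case of a vanishing second moment is settled by taking \<open>\<sigma>\<close>
  arbitrarily small.\<close>

locale bounded_second_moment = ball_pseudo_distribution +
  fixes \<sigma> :: real
  assumes sigma_pos: "0 < \<sigma>"
    and second_moment_le: "E (\<lambda>u. (lin d x u)\<^sup>2) \<le> \<sigma> * normsq d x"
begin

text \<open>The flattening of \<open>E u\<^sup>\<otimes>\<^sup>(\<^sup>k\<^sup>+\<^sup>2\<^sup>)\<close> into a \<open>d\<^sup>k\<^sup>+\<^sup>1 \<times> d\<close> matrix has norm at most \<open>\<sigma>\<close>: for its image \<open>B\<close> of \<open>x\<close>,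
  with \<open>P u = \<langle>B, u\<^sup>\<otimes>\<^sup>(\<^sup>k\<^sup>+\<^sup>1\<^sup>)\<rangle>\<close>, expand \<open>0 \<le> E (P u - \<sigma> \<langle>x, u\<rangle>)\<^sup>2\<close>.\<close>

lemma tensor_moment_variance:
  assumes deg: "2 * (2 * k + 2) \<le> t"
  shows "(\<Sum>\<alpha>\<in>tensor_index d k. \<Sum>i<d. (\<Sum>j<d. tensor_moment k \<alpha> i j * x j)\<^sup>2) \<le> \<sigma>\<^sup>2 * normsq d x"
proof -
  define B where "B = (\<lambda>\<alpha> i. \<Sum>j<d. tensor_moment k \<alpha> i j * x j)"
  let ?I = "tensor_index d k"
  define T where "T = (\<Sum>\<alpha>\<in>?I. \<Sum>i<d. (B \<alpha> i)\<^sup>2)"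
  define P where "P = (\<lambda>u. \<Sum>\<alpha>\<in>?I. tensor_power k u \<alpha> * lin d (B \<alpha>) u)"
  have B: "B \<alpha> i = E (\<lambda>u. tensor_power k u \<alpha> * u $ i * lin d x u)" for \<alpha> i
    by (simp add: B_def tensor_moment_def sum_distrib_left mult_ac flip: E_sum E_cmult)
  have polyP: "polyfun d (k + 1) P"
    unfolding P_def by (intro polyfun_sum polyfun_mult polyfun_tensor_power polyfun_lin)
  have PL: "E (\<lambda>u. P u * lin d x u) = T"
  proof -
    have "T = (\<Sum>\<alpha>\<in>?I. \<Sum>i<d. B \<alpha> i * E (\<lambda>u. tensor_power k u \<alpha> * u $ i * lin d x u))"
      by (simp add: T_def power2_eq_square flip: B)
    also have "\<dots> = E (\<lambda>u. \<Sum>\<alpha>\<in>?I. \<Sum>i<d. B \<alpha> i * (tensor_power k u \<alpha> * u $ i * lin d x u))"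
      by (simp add: E_sum E_cmult)
    also have "(\<lambda>u. \<Sum>\<alpha>\<in>?I. \<Sum>i<d. B \<alpha> i * (tensor_power k u \<alpha> * u $ i * lin d x u))
        = (\<lambda>u. P u * lin d x u)"
      unfolding P_def sum_distrib_right[of _ ?I]
      by (intro ext sum.cong refl) (simp add: sum_distrib_left sum_distrib_right mult_ac)
    finally show ?thesis by simp
  qed
  \<comment> \<open>Cauchy-Schwarz over \<alpha> splits off the tensor powers, whose total
    \<open>nsq u ^ k\<close> the ball constraint absorbs; the second moment bound then applies to
    each \<open>B \<alpha>\<close>.\<close>
  have PP: "E (\<lambda>u. (P u)\<^sup>2) \<le> \<sigma> * T"
  proof -
    have lins: "sosfun d 1 (\<lambda>u. \<Sum>\<alpha>\<in>?I. (lin d (B \<alpha>) u)\<^sup>2)"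
      by (intro sosfun_sum sosfun_square polyfun_lin)
    \<comment> \<open>The factor \<open>1\<^sup>2\<close> is the trivial multiplier
      \<open>h\<close>, of degree 0.\<close>
    have "E (\<lambda>u. (P u)\<^sup>2 * 1\<^sup>2) \<le> E (\<lambda>u. (\<Sum>\<alpha>\<in>?I. (tensor_power k u \<alpha>)\<^sup>2) * (\<Sum>\<alpha>\<in>?I. (lin d (B \<alpha>) u)\<^sup>2) * 1\<^sup>2)"
      unfolding P_def
      by (rule E_cauchy_schwarz[OF _ _ sosfun_square[OF polyfun_const[where s = 0]], where s = k and r = 1])
        (use deg in \<open>auto intro: polyfun_tensor_power polyfun_lin[unfolded One_nat_def]\<close>)
    also have "\<dots> = E (\<lambda>u. nsq u ^ k * (\<Sum>\<alpha>\<in>?I. (lin d (B \<alpha>) u)\<^sup>2))"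
      by (simp add: tensor_power_normsq)
    also have "\<dots> \<le> E (\<lambda>u. \<Sum>\<alpha>\<in>?I. (lin d (B \<alpha>) u)\<^sup>2)"
      by (rule E_ball_power_sos[OF lins]) (use deg in auto)
    also have "\<dots> \<le> (\<Sum>\<alpha>\<in>?I. \<sigma> * normsq d (B \<alpha>))"
      unfolding E_sum by (intro sum_mono second_moment_le)
    also have "\<dots> = \<sigma> * T" by (simp add: T_def sum_distrib_left)
    finally show ?thesis by simp
  qed
  have "sosfun d (k + 1) (\<lambda>u. (P u - \<sigma> * lin d x u)\<^sup>2)"
    by (intro sosfun_square polyfun_diff polyP polyfun_cmult polyfun_mono[OF polyfun_lin]) simp
  then have "0 \<le> E (\<lambda>u. (P u - \<sigma> * lin d x u)\<^sup>2)" using deg by (intro E_sos) auto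
  also have "(\<lambda>u. (P u - \<sigma> * lin d x u)\<^sup>2)
      = (\<lambda>u. (P u)\<^sup>2 + (\<sigma>\<^sup>2 * (lin d x u)\<^sup>2 - (2 * \<sigma>) * (P u * lin d x u)))"
    by (simp add: power2_eq_square algebra_simps)
  also have "E \<dots> = E (\<lambda>u. (P u)\<^sup>2) + (\<sigma>\<^sup>2 * E (\<lambda>u. (lin d x u)\<^sup>2) - 2 * \<sigma> * T)"
    by (simp only: E_add E_diff E_cmult PL)
  also have "\<dots> \<le> \<sigma> * T + (\<sigma>\<^sup>2 * (\<sigma> * normsq d x) - 2 * \<sigma> * T)"
    by (intro add_mono PP diff_mono mult_left_mono second_moment_le) (use sigma_pos in auto)
  finally have "\<sigma> * T \<le> \<sigma> * (\<sigma>\<^sup>2 * normsq d x)" by (simp add: power2_eq_square algebra_simps)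
  then show ?thesis using sigma_pos by (simp add: T_def B_def)
qed

text \<open>The even moments \<open>b j = E \<langle>a, u\<rangle>\<^sup>2\<^sup>j\<close> form a convex sequence, hence
  \<open>m * (b m - b (m + 1)) \<le> b 1 - b (m + 1)\<close>.\<close>

lemma moment_drop:
  assumes a: "normsq d a = 1" and m: "0 < m" and deg: "4 * m + 4 \<le> t"
  shows "real m * (E (\<lambda>u. lin d a u ^ (2 * m)) - E (\<lambda>u. lin d a u ^ (2 * m + 2))) \<le> \<sigma>"
proof -
  define b where "b = (\<lambda>j. E (\<lambda>u. lin d a u ^ (2 * j)))"
  have convex: "b (Suc j) - b (Suc (Suc j)) \<le> b j - b (Suc j)" if "j < m" for j
  proof -
    \<comment> \<open>The second difference of \<open>b\<close> is the pseudo-expectation of the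
      square of this function.\<close>
    have "polyfun d (j + 2) (\<lambda>u. lin d a u ^ j * (1 - lin d a u ^ 2))"
      by (intro polyfun_mult polyfun_diff polyfun_const polyfun_power polyfun_lin)
    then have "0 \<le> E (\<lambda>u. (lin d a u ^ j * (1 - lin d a u ^ 2))\<^sup>2)"
      using that deg by (intro E_sos[OF sosfun_square]) auto
    also have "(\<lambda>u. (lin d a u ^ j * (1 - lin d a u ^ 2))\<^sup>2)
       = (\<lambda>u. lin d a u ^ (2 * j) + (lin d a u ^ (2 * Suc (Suc j)) - 2 * lin d a u ^ (2 * Suc j)))"
      by (rule ext, simp add: power_mult power2_eq_square algebra_simps)
    also have "E \<dots> = b j + (b (Suc (Suc j)) - 2 * b (Suc j))"
      unfolding b_def E_add E_diff E_cmult ..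
    finally show ?thesis by simp
  qed
  have mono: "b m - b (Suc m) \<le> b j - b (Suc j)" if "j \<le> m" for j
    using that
  proof (induction rule: inc_induct)
    case (step n) then show ?case using convex[of n] by simp
  qed simp
  \<comment> \<open>The sum starts at 1 so that telescoping leaves \<open>b 1\<close>, a second
    moment and hence at most \<open>\<sigma>\<close>; \<open>b 0\<close> would only be 1.\<close>
  have "real m * (b m - b (Suc m)) = (\<Sum>j\<in>{1..<Suc m}. b m - b (Suc m))" by simp
  also have "\<dots> \<le> (\<Sum>j\<in>{1..<Suc m}. b j - b (Suc j))" by (intro sum_mono mono) auto
  also have "\<dots> = b 1 - b (Suc m)"
    using sum_Suc_diff'[of 1 "Suc m" "\<lambda>j. - b j"] by simp
  also have "\<dots> \<le> \<sigma>"
  proof -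
    have "0 \<le> b (Suc m)" unfolding b_def
      by (rule E_sos[OF sosfun_even_power[OF polyfun_lin]]) (use deg in auto)
    moreover have "b 1 \<le> \<sigma>" using second_moment_le[of a] a by (simp add: b_def)
    ultimately show ?thesis by simp
  qed
  finally show ?thesis by (simp add: b_def)
qed

text \<open>Since \<open>y\<close> is orthogonal to \<open>a\<close>, \<open>lin d y u\<close> sees
  only the part \<open>w\<close> of \<open>u\<close> orthogonal to \<open>a\<close>. Cauchy-Schwarz
  and the ball constraint leave the drop from moment \<open>k\<close> to moment
  \<open>k + 2\<close>, and \<open>moment_drop\<close> at \<open>k div 2\<close> yields the factor
  2.\<close>

lemma orthogonal_moment:
  assumes a: "normsq d a = 1" and y: "(\<Sum>i<d. a i * y i) = 0" and k: "0 < k" "even k"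
    and deg: "2 * k + 6 \<le> t"
  shows "real k * E (\<lambda>u. lin d a u ^ k * (lin d y u)\<^sup>2) \<le> 2 * \<sigma> * normsq d y"
proof -
  define w where "w = (\<lambda>i u. u $ i - lin d a u * a i)"
  have polyw: "polyfun d 1 (w i)" if "i < d" for i
    unfolding w_def using polyfun_coord[of i d 0] that polyfun_cmult[OF polyfun_lin, of "a i" a]
    by (intro polyfun_diff) (simp_all add: mult.commute)
  have sosk: "sosfun d (k div 2) (\<lambda>u. lin d a u ^ k)"
    by (rule sosfun_even_power[OF polyfun_lin k(2)])
  have yw: "(\<Sum>i<d. y i * w i u) = lin d y u" for u
  proof -
    have "(\<Sum>i<d. y i * w i u) = (\<Sum>i<d. y i * u $ i - lin d a u * (a i * y i))"
      by (intro sum.cong refl) (simp add: w_def algebra_simps)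
    also have "\<dots> = lin d y u - lin d a u * (\<Sum>i<d. a i * y i)"
      by (simp only: sum_subtractf sum_distrib_left)
    finally have "(\<Sum>i<d. y i * w i u) = \<dots>" .
    then show ?thesis by (simp add: y)
  qed
  have ww: "(\<Sum>i<d. (w i u)\<^sup>2) = nsq u - (lin d a u)\<^sup>2" for u
  proof -
    have "(\<Sum>i<d. (w i u)\<^sup>2) = (\<Sum>i<d. (u $ i)\<^sup>2 - 2 * lin d a u * (a i * u $ i) + (lin d a u)\<^sup>2 * (a i)\<^sup>2)"
      by (intro sum.cong refl) (simp add: w_def power2_eq_square algebra_simps)
    also have "\<dots> = nsq u - 2 * lin d a u * lin d a u + (lin d a u)\<^sup>2 * normsq d a"
      by (simp only: sum.distrib sum_subtractf sum_distrib_left)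
    finally show ?thesis unfolding a by (simp add: power2_eq_square)
  qed
  have "E (\<lambda>u. lin d a u ^ k * (lin d y u)\<^sup>2) = E (\<lambda>u. (\<Sum>i<d. y i * w i u)\<^sup>2 * lin d a u ^ k)"
    by (simp add: yw mult.commute)
  also have "\<dots> \<le> E (\<lambda>u. (\<Sum>i<d. (y i)\<^sup>2) * (\<Sum>i<d. (w i u)\<^sup>2) * lin d a u ^ k)"
    by (rule E_cauchy_schwarz[OF polyfun_const[where s=0] polyw sosk]) (use deg in auto)
  also have "\<dots> = E (\<lambda>u. normsq d y * (nsq u * lin d a u ^ k - lin d a u ^ (k + 2)))"
    unfolding ww by (simp add: algebra_simps power2_eq_square)
  also have "\<dots> = normsq d y * (E (\<lambda>u. nsq u * lin d a u ^ k) - E (\<lambda>u. lin d a u ^ (k + 2)))"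
    by (simp only: E_cmult E_diff)
  also have "\<dots> \<le> normsq d y * (E (\<lambda>u. lin d a u ^ k) - E (\<lambda>u. lin d a u ^ (k + 2)))"
    by (intro mult_left_mono diff_mono order.refl E_ball_sos[OF sosk] sum_nonneg) (use deg in auto)
  finally have "real k * E (\<lambda>u. lin d a u ^ k * (lin d y u)\<^sup>2)
     \<le> real k * (normsq d y * (E (\<lambda>u. lin d a u ^ k) - E (\<lambda>u. lin d a u ^ (k + 2))))"
    by (intro mult_left_mono) auto
  also have "\<dots> = normsq d y * (2 * (real (k div 2) *
      (E (\<lambda>u. lin d a u ^ (2 * (k div 2))) - E (\<lambda>u. lin d a u ^ (2 * (k div 2) + 2)))))"
    using k by (simp add: real_of_nat_div)
  also have "\<dots> \<le> normsq d y * (2 * \<sigma>)"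
    by (intro mult_left_mono moment_drop[OF a] sum_nonneg) (use deg k in auto)
  finally show ?thesis by (simp add: mult_ac)
qed

end

section \<open>Top eigenvectors as maximisers of the quadratic form\<close>

definition qform :: "nat \<Rightarrow> (nat \<times> nat \<Rightarrow> real) \<Rightarrow> (nat \<Rightarrow> real) \<Rightarrow> real" where
  "qform d m x = (\<Sum>i<d. \<Sum>j<d. m (i, j) * (x i * x j))"

text \<open>Coordinates from \<open>d\<close> on are pinned to 0, which makes the unit sphere a
  compact set of functions.\<close>

definition sphere_fun :: "nat \<Rightarrow> (nat \<Rightarrow> real) set" where
  "sphere_fun d = {x. normsq d x = 1 \<and> (\<forall>i\<ge>d. x i = 0)}"

text \<open>Maximisers of the quadratic form stand in for top eigenvectors because compactness
  yields both their existence and the measurability of the event.\<close>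

definition is_top :: "nat \<Rightarrow> (nat \<times> nat \<Rightarrow> real) \<Rightarrow> (nat \<Rightarrow> real) \<Rightarrow> bool" where
  "is_top d m x \<longleftrightarrow> x \<in> sphere_fun d \<and> (\<forall>w \<in> sphere_fun d. qform d m w \<le> qform d m x)"

lemma continuous_coordinate [continuous_intros]: "continuous_on S (\<lambda>x :: 'a \<Rightarrow> real. x i)"
  by (rule continuous_on_subset[OF continuous_on_product_coordinates]) simp

lemma tendsto_coordinate:
  fixes f :: "nat \<Rightarrow> 'a \<Rightarrow> real"
  assumes "f \<longlonglongrightarrow> y" shows "(\<lambda>n. f n i) \<longlonglongrightarrow> y i"
  using continuous_on_tendsto_compose[OF continuous_coordinate[of UNIV i] assms] by simp

text \<open>A closed subset of a product of intervals and points, compact by Tychonoff's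
  theorem.\<close>

lemma compact_sphere_fun: "compact (sphere_fun d)"
proof -
  let ?K = "\<lambda>i. if i < d then {-1..1} else {0 :: real}"
  have "compactin (product_topology (\<lambda>i. euclidean) UNIV) (PiE UNIV ?K)"
    unfolding compactin_PiE by auto
  then have "compact (PiE UNIV ?K)" by (simp only: euclidean_product_topology compactin_euclidean_iff)
  moreover have "closed (sphere_fun d)"
    unfolding sphere_fun_def by (intro closed_Collect_conj closed_Collect_eq closed_Collect_all
        closed_Collect_imp continuous_intros) auto
  moreover have "sphere_fun d \<subseteq> PiE UNIV ?K"
  proof
    fix x assume x: "x \<in> sphere_fun d"
    have "x i \<in> {-1..1}" if "i < d" for i
    proof -
      have "(x i)\<^sup>2 \<le> normsq d x" by (rule member_le_sum) (use that in auto)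
      then have "(x i)\<^sup>2 \<le> 1" using x by (simp add: sphere_fun_def)
      then show ?thesis by (simp add: abs_le_iff abs_square_le_1)
    qed
    then show "x \<in> PiE UNIV ?K" using x by (auto simp: sphere_fun_def)
  qed
  ultimately show ?thesis by (metis compact_Int_closed inf.absorb2)
qed

lemma continuous_qform: "continuous_on S (qform d m)"
  unfolding qform_def by (intro continuous_intros)

lemma is_top_exists:
  assumes "0 < d" shows "\<exists>x. is_top d m x"
proof -
  have "(\<lambda>i. if i = 0 then 1 else 0) \<in> sphere_fun d"
    using assms by (auto simp: sphere_fun_def if_distrib[of "\<lambda>x. x\<^sup>2"] cong: if_cong)
  then have "sphere_fun d \<noteq> {}" by blast
  from continuous_attains_sup[OF compact_sphere_fun this continuous_qform]
  show ?thesis unfolding is_top_def by blast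
qed

text \<open>The source of measurability. For a convergent sequence of matrices, compactness of the
  sphere gives a convergent subsequence of maximisers in \<open>K\<close>, and the maximality
  inequalities pass to the limit.\<close>

lemma closed_is_top:
  fixes K :: "(nat \<Rightarrow> real) set"
  assumes K: "closed K"
  shows "closed {m. \<exists>x\<in>K. is_top d m x}"
  unfolding closed_sequential_limits
proof (intro allI impI, elim conjE)
  fix ms l assume "\<forall>n. ms n \<in> {m. \<exists>x\<in>K. is_top d m x}" and lim: "ms \<longlonglongrightarrow> l"
  then obtain xs where xs: "\<And>n. xs n \<in> K" "\<And>n. is_top d (ms n) (xs n)" by simp metis
  have "compact (sphere_fun d \<inter> K)" using compact_sphere_fun K by (rule compact_Int_closed)
  then have "seq_compact (sphere_fun d \<inter> K)" by (rule compact_imp_seq_compact)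
  moreover have "\<forall>n. xs n \<in> sphere_fun d \<inter> K" using xs by (auto simp: is_top_def)
  ultimately obtain x r where x: "x \<in> sphere_fun d \<inter> K" "strict_mono r" "(xs \<circ> r) \<longlonglongrightarrow> x"
    unfolding seq_compact_def by meson
  have ms: "(\<lambda>n. ms (r n) p) \<longlonglongrightarrow> l p" for p
    by (rule tendsto_coordinate) (use LIMSEQ_subseq_LIMSEQ[OF lim x(2)] in \<open>simp add: o_def\<close>)
  have xr: "(\<lambda>n. xs (r n) i) \<longlonglongrightarrow> x i" for i
    by (rule tendsto_coordinate) (use x(3) in \<open>simp add: o_def\<close>)
  have "qform d l w \<le> qform d l x" if "w \<in> sphere_fun d" for w
  proof (rule LIMSEQ_le)
    show "(\<lambda>n. qform d (ms (r n)) w) \<longlonglongrightarrow> qform d l w"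
      unfolding qform_def by (intro tendsto_intros ms)
    show "(\<lambda>n. qform d (ms (r n)) (xs (r n))) \<longlonglongrightarrow> qform d l x"
      unfolding qform_def by (intro tendsto_intros ms xr)
    show "\<exists>N. \<forall>n\<ge>N. qform d (ms (r n)) w \<le> qform d (ms (r n)) (xs (r n))"
      using xs that by (auto simp: is_top_def)
  qed
  then show "l \<in> {m. \<exists>x\<in>K. is_top d m x}" using x(1) by (auto simp: is_top_def)
qed

lemma linear_term_eq_0:
  fixes b c :: real
  assumes "\<And>s. 0 \<le> s * b + s\<^sup>2 * c" shows "b = 0"
proof -
  \<comment> \<open>As \<open>q > c\<close>, at \<open>s = - b / q\<close> the quadratic term cannot
    compensate a nonzero linear one.\<close>
  define q where "q = \<bar>c\<bar> + 1"
  have q: "q > 0" "c + 1 \<le> q" by (auto simp: q_def)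
  have "0 \<le> q\<^sup>2 * ((- b / q) * b + (- b / q)\<^sup>2 * c)" using assms[of "- b / q"] by (intro mult_nonneg_nonneg) auto
  also have "\<dots> = b\<^sup>2 * (c - q)" using q by (simp add: power2_eq_square field_simps)
  also have "\<dots> \<le> b\<^sup>2 * (-1)" using q by (intro mult_left_mono) auto
  finally show ?thesis by simp
qed

lemma qform_le_is_top:
  assumes "is_top d m x"
  shows "qform d m y \<le> qform d m x * normsq d y"
proof (cases "normsq d y = 0")
  case True
  then have "\<forall>i<d. y i = 0" by (subst (asm) sum_nonneg_eq_0_iff) auto
  then have "qform d m y = 0" by (simp add: qform_def)
  then show ?thesis using True by simp
next
  case False
  define n where "n = sqrt (normsq d y)"
  have n2: "n\<^sup>2 = normsq d y" by (simp add: n_def sum_nonneg)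
  have n: "n \<noteq> 0" using False by (simp add: n_def)
  define w where "w = (\<lambda>i. if i < d then y i / n else 0)"
  have "normsq d w = (\<Sum>i<d. (y i)\<^sup>2 / n\<^sup>2)" by (simp add: w_def power_divide)
  then have "w \<in> sphere_fun d"
    using n by (simp add: sphere_fun_def w_def flip: sum_divide_distrib n2)
  then have "qform d m w \<le> qform d m x" using assms by (simp add: is_top_def)
  also have "qform d m w = qform d m y / n\<^sup>2"
    by (simp add: qform_def w_def sum_divide_distrib power2_eq_square)
  finally show ?thesis using n by (simp add: field_simps flip: n2)
qed

text \<open>First-order optimality: moving \<open>x\<close> by \<open>s\<close> times the residual
  \<open>z\<close> changes the slack in \<open>qform_le_is_top\<close> by
  \<open>2 * s * normsq d z\<close> to first order, so \<open>z\<close> must vanish.\<close>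

lemma is_top_imp_eigen:
  assumes top: "is_top d m x" and sym: "\<And>i j. i < d \<Longrightarrow> j < d \<Longrightarrow> m (i, j) = m (j, i)"
    and i: "i < d"
  shows "(\<Sum>j<d. m (i, j) * x j) = qform d m x * x i"
proof -
  define l where "l = qform d m x"
  define z where "z = (\<lambda>i. l * x i - (\<Sum>j<d. m (i, j) * x j))"
  have nx: "normsq d x = 1" using top by (simp add: is_top_def sphere_fun_def)
  have mz: "(\<Sum>i<d. \<Sum>j<d. m (i, j) * (x j * z i)) = (\<Sum>i<d. (\<Sum>j<d. m (i, j) * x j) * z i)"
    by (simp add: sum_distrib_right mult.assoc)
  have mz': "(\<Sum>i<d. \<Sum>j<d. m (i, j) * (x i * z j)) = (\<Sum>i<d. \<Sum>j<d. m (i, j) * (x j * z i))"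
    by (subst sum.swap) (auto intro!: sum.cong simp: sym)
  have "0 \<le> s * (2 * normsq d z) + s\<^sup>2 * (l * normsq d z - qform d m z)" for s
  proof -
    have "qform d m (\<lambda>i. x i + s * z i) = (\<Sum>i<d. \<Sum>j<d. m (i, j) * (x i * x j)
        + s * (m (i, j) * (x i * z j)) + s * (m (i, j) * (x j * z i)) + s\<^sup>2 * (m (i, j) * (z i * z j)))"
      unfolding qform_def by (intro sum.cong refl) (simp add: power2_eq_square algebra_simps)
    also have "\<dots> = l + s * (\<Sum>i<d. \<Sum>j<d. m (i, j) * (x i * z j))
        + s * (\<Sum>i<d. \<Sum>j<d. m (i, j) * (x j * z i)) + s\<^sup>2 * qform d m z"
      unfolding l_def qform_def by (simp only: sum.distrib sum_distrib_left)
    finally have q: "qform d m (\<lambda>i. x i + s * z i)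
      = l + 2 * s * (\<Sum>i<d. (\<Sum>j<d. m (i, j) * x j) * z i) + s\<^sup>2 * qform d m z"
      by (simp add: mz mz')
    have "normsq d (\<lambda>i. x i + s * z i) = (\<Sum>i<d. (x i)\<^sup>2 + 2 * s * (x i * z i) + s\<^sup>2 * (z i)\<^sup>2)"
      by (intro sum.cong refl) (simp add: power2_eq_square algebra_simps)
    also have "\<dots> = 1 + 2 * s * (\<Sum>i<d. x i * z i) + s\<^sup>2 * normsq d z"
      by (simp only: sum.distrib sum_distrib_left nx)
    finally have n: "normsq d (\<lambda>i. x i + s * z i) = \<dots>" .
    have "normsq d z = (\<Sum>i<d. l * (x i * z i) - (\<Sum>j<d. m (i, j) * x j) * z i)"
      by (intro sum.cong refl) (simp add: z_def power2_eq_square algebra_simps)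
    also have "\<dots> = l * (\<Sum>i<d. x i * z i) - (\<Sum>i<d. (\<Sum>j<d. m (i, j) * x j) * z i)"
      by (simp only: sum_subtractf sum_distrib_left)
    finally have z: "(\<Sum>i<d. (\<Sum>j<d. m (i, j) * x j) * z i) = l * (\<Sum>i<d. x i * z i) - normsq d z"
      by simp
    show ?thesis
      using qform_le_is_top[OF top, of "\<lambda>i. x i + s * z i", folded l_def, unfolded q n z]
      by (simp add: algebra_simps)
  qed
  then have "2 * normsq d z = 0" by (rule linear_term_eq_0)
  then have "z i = 0" using i by (simp add: sum_nonneg_eq_0_iff)
  then show ?thesis by (simp add: z_def l_def)
qed

section \<open>Transfer to \<open>vec\<close> and \<open>mat\<close>\<close>

lemma vnorm_vec: "vnorm (vec d x) = sqrt (normsq d x)"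
  by (simp add: vnorm_def scalar_prod_def atLeast0LessThan power2_eq_square)

lemma vec_neq_0:
  assumes "normsq d x = 1" shows "vec d x \<noteq> 0\<^sub>v d"
proof
  assume "vec d x = 0\<^sub>v d"
  then have "x i = 0" if "i < d" for i using that by (metis index_vec index_zero_vec(1))
  then show False using assms by simp
qed

lemma eigenvector_mat_iff:
  "eigenvector (mat d d m) (vec d x) l \<longleftrightarrow>
     vec d x \<noteq> 0\<^sub>v d \<and> (\<forall>i<d. (\<Sum>j<d. m (i, j) * x j) = l * x i)"
  unfolding eigenvector_def
  by (auto simp: vec_eq_iff scalar_prod_def atLeast0LessThan)

lemma eigen_qform:
  assumes "\<forall>i<d. (\<Sum>j<d. m (i, j) * x j) = l * x i"
  shows "qform d m x = l * normsq d x"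
proof -
  have "qform d m x = (\<Sum>i<d. x i * (\<Sum>j<d. m (i, j) * x j))"
    by (simp add: qform_def sum_distrib_left mult_ac)
  also have "\<dots> = l * normsq d x"
    using assms by (simp add: sum_distrib_left power2_eq_square mult_ac)
  finally show ?thesis .
qed

lemma vec_as_fun: "u \<in> carrier_vec d \<Longrightarrow> \<exists>x. u = vec d x \<and> (\<forall>i\<ge>d. x i = 0)"
  by (rule exI[of _ "\<lambda>i. if i < d then u $ i else 0"]) auto

text \<open>Forwards, a maximiser exists and is an eigenvector, so the largest eigenvalue is at
  least the maximum of the form. Backwards, every eigenvalue is a Rayleigh quotient.\<close>

lemma top_eigenvector_iff:
  assumes sym: "\<And>i j. i < d \<Longrightarrow> j < d \<Longrightarrow> m (i, j) = m (j, i)" and d: "0 < d"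
  shows "top_eigenvector (mat d d m) u \<longleftrightarrow> (\<exists>x. u = vec d x \<and> is_top d m x)"
proof
  assume u: "top_eigenvector (mat d d m) u"
  then obtain l where l: "eigenvector (mat d d m) u l" "vnorm u = 1"
      "\<And>r. eigenvalue (mat d d m) r \<Longrightarrow> r \<le> l"
    unfolding top_eigenvector_def by blast
  then have "u \<in> carrier_vec d" by (simp add: eigenvector_def)
  then obtain x where x: "u = vec d x" "\<forall>i\<ge>d. x i = 0" using vec_as_fun by blast
  have nx: "normsq d x = 1" using l(2) unfolding x(1) vnorm_vec by simp
  have lx: "l = qform d m x" using eigen_qform[of d m x l] l(1) nx
    unfolding x(1) eigenvector_mat_iff by simp
  obtain y where y: "is_top d m y" using is_top_exists[OF d] by blast
  then have ny: "normsq d y = 1" by (simp add: is_top_def sphere_fun_def)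
  have "vec d y \<noteq> 0\<^sub>v d" using ny by (rule vec_neq_0)
  then have "eigenvector (mat d d m) (vec d y) (qform d m y)"
    unfolding eigenvector_mat_iff using is_top_imp_eigen[OF y sym] by blast
  then have "qform d m y \<le> l" using l(3) unfolding eigenvalue_def by blast
  then have "is_top d m x" using y nx x(2) lx unfolding is_top_def sphere_fun_def by force
  then show "\<exists>x. u = vec d x \<and> is_top d m x" using x by blast
next
  assume "\<exists>x. u = vec d x \<and> is_top d m x"
  then obtain x where u: "u = vec d x" and x: "is_top d m x" by blast
  then have nx: "normsq d x = 1" by (simp add: is_top_def sphere_fun_def)
  then have "vec d x \<noteq> 0\<^sub>v d" by (rule vec_neq_0)
  then have "eigenvector (mat d d m) u (qform d m x)"
    unfolding eigenvector_mat_iff u using is_top_imp_eigen[OF x sym] by blast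
  moreover have "r \<le> qform d m x" if r: "eigenvalue (mat d d m) r" for r
  proof -
    obtain v where v: "eigenvector (mat d d m) v r" using r by (auto simp: eigenvalue_def)
    then obtain y where y: "v = vec d y" using vec_as_fun[of v d] by (auto simp: eigenvector_def)
    have "r * normsq d y \<le> qform d m x * normsq d y"
      using eigen_qform[of d m y r] v qform_le_is_top[OF x, of y] unfolding y eigenvector_mat_iff by simp
    moreover have "normsq d y > 0"
    proof -
      obtain i where "i < d" "y i \<noteq> 0" using v unfolding y eigenvector_mat_iff by (auto simp: vec_eq_iff)
      then show ?thesis by (intro sum_pos2[of _ i]) auto
    qed
    ultimately show ?thesis by simp
  qed
  moreover have "vnorm u = 1" by (simp add: u vnorm_vec nx)
  ultimately show "top_eigenvector (mat d d m) u" unfolding top_eigenvector_def by blast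
qed

section \<open>Powers of symmetric matrices\<close>

type_synonym rmat = "nat \<Rightarrow> nat \<Rightarrow> real"

definition mm :: "nat \<Rightarrow> rmat \<Rightarrow> rmat \<Rightarrow> rmat" where
  "mm d A B = (\<lambda>i j. \<Sum>l<d. A i l * B l j)"

text \<open>Matrices vanish outside the \<open>d \<times> d\<close> block, so that the unit laws hold as equations between functions.\<close>

definition supp :: "nat \<Rightarrow> rmat \<Rightarrow> bool" where
  "supp d A \<longleftrightarrow> (\<forall>i j. \<not> (i < d \<and> j < d) \<longrightarrow> A i j = 0)"

definition mid :: "nat \<Rightarrow> rmat" where
  "mid d = (\<lambda>i j. if i = j \<and> i < d then 1 else 0)"

primrec mpow :: "nat \<Rightarrow> rmat \<Rightarrow> nat \<Rightarrow> rmat" where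
  "mpow d X 0 = mid d"
| "mpow d X (Suc n) = mm d X (mpow d X n)"

definition sym_mat :: "rmat \<Rightarrow> bool" where
  "sym_mat A \<longleftrightarrow> (\<forall>i j. A i j = A j i)"

definition mtr :: "nat \<Rightarrow> rmat \<Rightarrow> real" where
  "mtr d A = (\<Sum>i<d. A i i)"

text \<open>The Frobenius inner product.\<close>

definition fro :: "nat \<Rightarrow> rmat \<Rightarrow> rmat \<Rightarrow> real" where
  "fro d A B = (\<Sum>i<d. \<Sum>j<d. A i j * B i j)"

lemma mm_assoc: "mm d (mm d A B) C = mm d A (mm d B C)"
proof (intro ext)
  fix i j
  have "mm d (mm d A B) C i j = (\<Sum>l<d. \<Sum>r<d. A i r * B r l * C l j)"
    by (simp add: mm_def sum_distrib_right)
  also have "\<dots> = (\<Sum>r<d. \<Sum>l<d. A i r * B r l * C l j)" by (rule sum.swap)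
  finally show "mm d (mm d A B) C i j = mm d A (mm d B C) i j"
    by (simp add: mm_def sum_distrib_left mult.assoc)
qed

lemma supp_mm: "supp d A \<Longrightarrow> supp d B \<Longrightarrow> supp d (mm d A B)"
  by (auto simp: supp_def mm_def)

lemma supp_mid: "supp d (mid d)"
  by (auto simp: supp_def mid_def)

lemma supp_mpow: "supp d X \<Longrightarrow> supp d (mpow d X n)"
  by (induction n) (auto intro: supp_mm supp_mid)

lemma mm_mid_left: assumes "supp d A" shows "mm d (mid d) A = A"
proof (intro ext)
  fix i j
  have "mm d (mid d) A i j = (\<Sum>l<d. if l = i then A i j else 0)"
    unfolding mm_def by (intro sum.cong) (auto simp: mid_def)
  then show "mm d (mid d) A i j = A i j" using assms by (simp add: supp_def)
qed

lemma mm_mid_right: assumes "supp d A" shows "mm d A (mid d) = A"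
proof (intro ext)
  fix i j
  have "mm d A (mid d) i j = (\<Sum>l<d. if l = j then A i j else 0)"
    unfolding mm_def by (intro sum.cong) (auto simp: mid_def)
  then show "mm d A (mid d) i j = A i j" using assms by (simp add: supp_def)
qed

lemma mpow_add: "supp d X \<Longrightarrow> mm d (mpow d X a) (mpow d X b) = mpow d X (a + b)"
  by (induction a) (simp_all add: mm_mid_left supp_mpow mm_assoc)

lemma mpow_commute: "supp d X \<Longrightarrow> mm d (mpow d X n) X = mm d X (mpow d X n)"
  using mpow_add[of d X n 1] by (simp add: mm_mid_right)

lemma mm_transpose: "sym_mat A \<Longrightarrow> sym_mat B \<Longrightarrow> mm d A B i j = mm d B A j i"
  unfolding mm_def sym_mat_def by (metis (no_types, lifting) mult.commute sum.cong)

lemma sym_mpow: "sym_mat X \<Longrightarrow> supp d X \<Longrightarrow> sym_mat (mpow d X n)"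
proof (induction n)
  case 0 show ?case by (auto simp: sym_mat_def mid_def)
next
  case (Suc n)
  then show ?case unfolding sym_mat_def[of "mpow d X (Suc n)"]
    by (metis mm_transpose mpow.simps(2) mpow_commute)
qed

lemma mtr_commute: "mtr d (mm d A B) = mtr d (mm d B A)"
  unfolding mtr_def mm_def by (subst sum.swap) (simp add: mult.commute)

lemma fro_eq_mtr: "fro d (\<lambda>i j. A j i) B = mtr d (mm d A B)"
  unfolding fro_def mtr_def mm_def by (subst sum.swap) simp

lemma fro_transpose: "fro d (\<lambda>i j. A j i) (\<lambda>i j. B j i) = fro d A B"
  unfolding fro_def by (rule sum.swap)

lemma fro_mpow:
  assumes "supp d X" "sym_mat X"
  shows "fro d (mpow d X n) (mpow d X n) = mtr d (mpow d X (2 * n))"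
proof -
  have "(\<lambda>i j. mpow d X n j i) = mpow d X n"
    using sym_mpow[OF assms(2,1)] by (auto simp: sym_mat_def)
  then show ?thesis using fro_eq_mtr[of d "mpow d X n" "mpow d X n"] mpow_add[OF assms(1), of n n]
    by (simp add: mult_2)
qed

text \<open>The least index where the maximum is attained cannot be interior: its left neighbour is
  strictly smaller, against convexity.\<close>

lemma discrete_convex_le_endpoint:
  fixes h :: "nat \<Rightarrow> real"
  assumes conv: "\<And>i. 0 < i \<Longrightarrow> i < n \<Longrightarrow> 2 * h i \<le> h (i - 1) + h (i + 1)"
    and ends: "h n \<le> h 0" and i: "i \<le> n"
  shows "h i \<le> h 0"
proof -
  define M where "M = Max (h ` {..n})"
  have le: "h j \<le> M" if "j \<le> n" for j using that by (simp add: M_def)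
  have "M \<in> h ` {..n}" unfolding M_def by (intro Max_in) auto
  then have ex: "\<exists>j. j \<le> n \<and> h j = M" by auto
  define j where "j = (LEAST j. j \<le> n \<and> h j = M)"
  have j: "j \<le> n" "h j = M" using LeastI_ex[OF ex] by (simp_all add: j_def)
  consider "j = 0" | "j = n" | "0 < j" "j < n" using j by linarith
  then have "M \<le> h 0"
  proof cases
    case 3
    have "h (j - 1) \<noteq> M"
      using not_less_Least[of "j - 1" "\<lambda>j. j \<le> n \<and> h j = M"] 3 by (auto simp: j_def)
    then have "h (j - 1) < M" using le[of "j - 1"] 3 by linarith
    moreover have "h (j + 1) \<le> M" using le[of "j + 1"] 3 by simp
    ultimately show ?thesis using conv[OF 3] j by simp
  qed (use j ends in auto)
  then show ?thesis using le[OF i] by simp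
qed

text \<open>With \<open>W i = X\<^sup>i A X\<^sup>n\<^sup>-\<^sup>i\<close> one has \<open>tr (A X\<^sup>i\<^sup>+\<^sup>j A X\<^sup>2\<^sup>n\<^sup>-\<^sup>i\<^sup>-\<^sup>j) = \<langle>W i, W j\<rangle>\<close>, so these traces are
  midpoint convex in the exponent and largest at its extreme values.\<close>

lemma trace_interlace_le:
  assumes X: "supp d X" "sym_mat X" and A: "supp d A" "sym_mat A" and q: "q \<le> 2 * n"
  shows "mtr d (mm d A (mm d (mpow d X q) (mm d A (mpow d X (2 * n - q)))))
       \<le> fro d (mm d A (mpow d X n)) (mm d A (mpow d X n))"
proof -
  let ?P = "mpow d X"
  define W where "W = (\<lambda>i. mm d (?P i) (mm d A (?P (n - i))))"
  define f where "f = (\<lambda>q. mtr d (mm d A (mm d (?P q) (mm d A (?P (2 * n - q))))))"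
  note S = sym_mpow[OF X(2,1)]
  \<comment> \<open>Transposition reverses the factors, since \<open>A\<close> and the powers of
    \<open>X\<close> are symmetric.\<close>
  have WT: "W i j l = mm d (?P (n - i)) (mm d A (?P i)) l j" for i j l
  proof -
    have "W i j l = (\<Sum>r<d. ?P i j r * mm d A (?P (n - i)) r l)" by (simp add: W_def mm_def)
    also have "\<dots> = (\<Sum>r<d. mm d (?P (n - i)) A l r * ?P i r j)"
      using S[of i] mm_transpose[OF A(2) S[of "n - i"], of d]
      by (intro sum.cong refl) (simp add: sym_mat_def mult.commute)
    also have "\<dots> = mm d (mm d (?P (n - i)) A) (?P i) l j" by (simp add: mm_def)
    finally show ?thesis by (simp add: mm_assoc)
  qed
  have fW: "f (i + j) = fro d (W i) (W j)" if "i \<le> n" "j \<le> n" for i j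
  proof -
    have "fro d (W i) (W j) = fro d (\<lambda>r l. mm d (?P (n - i)) (mm d A (?P i)) l r) (W j)"
      by (simp only: WT[of i, symmetric])
    also have "\<dots> = mtr d (mm d (mm d (?P (n - i)) (mm d A (?P i))) (W j))"
      by (rule fro_eq_mtr)
    also have "\<dots> = mtr d (mm d (?P (n - i)) (mm d A (mm d (?P (i + j)) (mm d A (?P (n - j))))))"
      by (simp add: W_def mm_assoc flip: mpow_add[OF X(1)])
    also have "\<dots> = mtr d (mm d (mm d A (mm d (?P (i + j)) (mm d A (?P (n - j))))) (?P (n - i)))"
      by (rule mtr_commute)
    also have "\<dots> = mtr d (mm d A (mm d (?P (i + j)) (mm d A (mm d (?P (n - j)) (?P (n - i))))))"
      by (simp add: mm_assoc)
    also have "\<dots> = f (i + j)"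
      using that by (simp add: f_def mpow_add[OF X(1)] mult_2 add.commute[of j i])
    finally show ?thesis by simp
  qed
  have mid: "2 * f (i + j) \<le> f (i + i) + f (j + j)" if "i \<le> n" "j \<le> n" for i j
  proof -
    have "0 \<le> (\<Sum>r<d. \<Sum>l<d. (W i r l - W j r l)\<^sup>2)" by (intro sum_nonneg) auto
    also have "\<dots> = (\<Sum>r<d. \<Sum>l<d. W i r l * W i r l + W j r l * W j r l - 2 * (W i r l * W j r l))"
      by (intro sum.cong refl) (simp add: power2_eq_square algebra_simps)
    also have "\<dots> = fro d (W i) (W i) + fro d (W j) (W j) - 2 * fro d (W i) (W j)"
      unfolding fro_def by (simp only: sum.distrib sum_subtractf sum_distrib_left)
    finally show ?thesis using that by (simp add: fW)
  qed
  have W0: "W 0 = mm d A (?P n)" "W n = mm d (?P n) A"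
    using A X by (simp_all add: W_def mm_mid_left mm_mid_right supp_mm supp_mpow)
  \<comment> \<open>The two extreme products are transposes of each other, so they have the same
    Frobenius norm.\<close>
  have WnT: "W n = (\<lambda>i j. W 0 j i)"
    unfolding W0 by (intro ext mm_transpose S A(2))
  have "fro d (W n) (W n) = fro d (W 0) (W 0)" unfolding WnT by (rule fro_transpose)
  then have ends: "f (n + n) = f (0 + 0)" using fW[of n n] fW[of 0 0] by simp
  have diag: "f (i + i) \<le> f (0 + 0)" if i: "i \<le> n" for i
  proof (rule discrete_convex_le_endpoint[of n "\<lambda>i. f (i + i)", OF _ _ i])
    fix j assume "0 < j" "j < n"
    then show "2 * f (j + j) \<le> f (j - 1 + (j - 1)) + f (j + 1 + (j + 1))"
      using mid[of "j - 1" "j + 1"] by simp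
  qed (simp add: ends)
  have "f (i + j) \<le> f (0 + 0)" if "i \<le> n" "j \<le> n" for i j
    using mid[OF that] diag[OF that(1)]
      diag[OF that(2)] by linarith
  \<comment> \<open>Any exponent up to \<open>2 * n\<close> splits into two nearly equal parts,
    neither exceeding \<open>n\<close>.\<close>
  from this[of "q div 2" "q - q div 2"] q have "f q \<le> f (0 + 0)" by simp
  then show ?thesis using fW[of 0 0] W0(1) by (simp add: f_def)
qed

section \<open>Quadratic forms bounded by traces of powers\<close>

definition mqf :: "nat \<Rightarrow> rmat \<Rightarrow> (nat \<Rightarrow> real) \<Rightarrow> real" where
  "mqf d X x = (\<Sum>i<d. x i * (\<Sum>j<d. X i j * x j))"

lemma mqf_mpow_double:
  assumes "supp d X" "sym_mat X"
  shows "mqf d (mpow d X (2 * n)) x = normsq d (\<lambda>i. \<Sum>j<d. mpow d X n i j * x j)"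
proof -
  let ?P = "mpow d X n"
  have S: "?P i j = ?P j i" for i j using sym_mpow[OF assms(2,1)] by (auto simp: sym_mat_def)
  have "mpow d X (2 * n) = mm d ?P ?P" using mpow_add[OF assms(1), of n n] by (simp add: mult_2)
  then have "mqf d (mpow d X (2 * n)) x = (\<Sum>i<d. \<Sum>j<d. \<Sum>l<d. (?P l i * x i) * (?P l j * x j))"
    by (simp add: mqf_def mm_def sum_distrib_left sum_distrib_right S[of _ l for l] mult_ac)
  also have "\<dots> = (\<Sum>i<d. \<Sum>l<d. \<Sum>j<d. (?P l i * x i) * (?P l j * x j))"
    by (intro sum.cong refl sum.swap)
  also have "\<dots> = (\<Sum>l<d. \<Sum>i<d. \<Sum>j<d. (?P l i * x i) * (?P l j * x j))" by (rule sum.swap)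
  finally show ?thesis by (simp add: power2_eq_square sum_product)
qed

lemma mqf_square_le:
  assumes "normsq d x = 1"
  shows "(mqf d Y x)\<^sup>2 \<le> normsq d (\<lambda>i. \<Sum>j<d. Y i j * x j)"
  unfolding mqf_def using Cauchy_Schwarz_ineq_sum[of x "\<lambda>i. \<Sum>j<d. Y i j * x j" "{..<d}"] assms by simp

text \<open>Repeated squaring by Cauchy-Schwarz takes the place of diagonalising \<open>X\<close>;
  hence the exponents are powers of two.\<close>

lemma mqf_power_le:
  assumes X: "supp d X" "sym_mat X" and x: "normsq d x = 1"
  shows "\<bar>mqf d X x\<bar> ^ (2 ^ s) \<le> \<bar>mqf d (mpow d X (2 ^ s)) x\<bar>"
proof (induction s)
  case 0 show ?case using X by (simp add: mm_mid_right)
next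
  case (Suc s)
  have "\<bar>mqf d X x\<bar> ^ (2 ^ Suc s) = (\<bar>mqf d X x\<bar> ^ (2 ^ s))\<^sup>2" by (simp only: power_Suc2 power_mult)
  also have "\<dots> \<le> \<bar>mqf d (mpow d X (2 ^ s)) x\<bar>\<^sup>2" by (intro power_mono Suc.IH) auto
  also have "\<dots> \<le> normsq d (\<lambda>i. \<Sum>j<d. mpow d X (2 ^ s) i j * x j)"
    using mqf_square_le[OF x] by simp
  also have "\<dots> = mqf d (mpow d X (2 ^ Suc s)) x" by (simp add: mqf_mpow_double[OF X])
  finally show ?case by linarith
qed

text \<open>The form of an even power is the squared norm of the image of \<open>x\<close> under the
  half power, hence at most the squared Frobenius norm of the half power, which is the
  trace.\<close>

lemma mqf_power_le_trace:
  assumes X: "supp d X" "sym_mat X" and x: "normsq d x = 1"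
  shows "\<bar>mqf d X x\<bar> ^ (2 * 2 ^ s) \<le> mtr d (mpow d X (2 * 2 ^ s))"
proof -
  have "\<bar>mqf d X x\<bar> ^ (2 * 2 ^ s) \<le> \<bar>mqf d (mpow d X (2 * 2 ^ s)) x\<bar>"
    using mqf_power_le[OF assms, of "Suc s"] by simp
  also have "\<dots> = normsq d (\<lambda>i. \<Sum>j<d. mpow d X (2 ^ s) i j * x j)"
    by (simp add: mqf_mpow_double[OF X] sum_nonneg)
  also have "\<dots> \<le> (\<Sum>i<d. (\<Sum>j<d. (mpow d X (2 ^ s) i j)\<^sup>2) * normsq d x)"
    by (intro sum_mono Cauchy_Schwarz_ineq_sum)
  also have "\<dots> = mtr d (mpow d X (2 * 2 ^ s))"
    by (simp only: x fro_mpow[OF X, symmetric] mult_1_right) (simp add: fro_def power2_eq_square)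
  finally show ?thesis .
qed

section \<open>Trace moments of Gaussian matrices\<close>

abbreviation gauss :: "'a set \<Rightarrow> ('a \<Rightarrow> real) measure" where
  "gauss I \<equiv> Pi\<^sub>M I (\<lambda>_. std_normal_distribution)"

lemma prob_space_std_normal: "prob_space std_normal_distribution"
  by (rule prob_space_normal_density) simp

interpretation std_normal: product_sigma_finite "\<lambda>_ :: 'a. std_normal_distribution"
  unfolding product_sigma_finite_def
  by (intro allI prob_space_imp_sigma_finite prob_space_std_normal)

lemma prob_space_gauss: "prob_space (gauss I)"
  by (intro prob_space_PiM prob_space_std_normal)

abbreviation std_moment :: "nat \<Rightarrow> real" where
  "std_moment n \<equiv> (\<integral>x. x ^ n \<partial>std_normal_distribution)"

text \<open>Integration by parts for a monomial in one variable. For \<open>n = 0\<close> the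
  truncated \<open>n - 1\<close> is harmless because of the factor \<open>real n\<close>.\<close>

lemma std_moment_Suc: "std_moment (Suc n) = real n * std_moment (n - 1)"
proof (cases "even n")
  case True
  then have "std_moment (Suc n) = 0"
    by (intro integral_std_normal_distribution_moment_odd) auto
  moreover have "real n * std_moment (n - 1) = 0"
    using True integral_std_normal_distribution_moment_odd[of "n - 1"] by (cases n) auto
  ultimately show ?thesis by simp
next
  case False
  then obtain k where k: "n = 2 * k + 1" by (elim oddE)
  have "std_moment (Suc n) = fact (2 * Suc k) / (2 ^ Suc k * fact (Suc k))"
    using std_normal_distribution_even_moments(1)[of "Suc k"] by (simp add: k)
  also have "\<dots> = real (2 * k + 1) * (fact (2 * k) / (2 ^ k * fact k))"
  proof -
    define c where "c = 2 * real (Suc k)"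
    have "fact (2 * Suc k) = c * (real (2 * k + 1) * fact (2 * k))"
      by (simp add: c_def algebra_simps)
    moreover have "2 ^ Suc k * fact (Suc k) = c * (2 ^ k * fact k)"
      by (simp add: c_def algebra_simps)
    moreover have "c \<noteq> 0" by (simp add: c_def)
    ultimately show ?thesis
      by (metis mult_divide_mult_cancel_left times_divide_eq_right)
  qed
  also have "\<dots> = real n * std_moment (n - 1)"
    using std_normal_distribution_even_moments(1)[of k] by (simp add: k)
  finally show ?thesis .
qed

section \<open>Integration by parts for polynomials in Gaussian variables\<close>

abbreviation gmonom :: "'a set \<Rightarrow> ('a \<Rightarrow> nat) \<Rightarrow> ('a \<Rightarrow> real) \<Rightarrow> real" where
  "gmonom I n g \<equiv> (\<Prod>i\<in>I. g i ^ n i)"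

lemma integrable_gmonom: "finite I \<Longrightarrow> integrable (gauss I) (gmonom I n)"
  by (intro std_normal.product_integrable_prod integrable_std_normal_distribution_moment)

lemma integral_gmonom:
  "finite I \<Longrightarrow> (\<integral>g. gmonom I n g \<partial>gauss I) = (\<Prod>i\<in>I. std_moment (n i))"
  by (intro std_normal.product_integral_prod integrable_std_normal_distribution_moment)

text \<open>A certificate that \<open>F'\<close> is the partial derivative of the polynomial
  \<open>F\<close> in coordinate \<open>\<alpha>\<close>. As a relation it needs no normal form of
  polynomials, and linear properties follow by induction from monomials.\<close>

inductive poly_deriv ::
  "'a set \<Rightarrow> 'a \<Rightarrow> (('a \<Rightarrow> real) \<Rightarrow> real) \<Rightarrow> (('a \<Rightarrow> real) \<Rightarrow> real) \<Rightarrow> bool" for I \<alpha> where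
  monom: "poly_deriv I \<alpha> (gmonom I n) (\<lambda>g. real (n \<alpha>) * gmonom I (n(\<alpha> := n \<alpha> - 1)) g)"
| add: "poly_deriv I \<alpha> F F' \<Longrightarrow> poly_deriv I \<alpha> G G' \<Longrightarrow>
    poly_deriv I \<alpha> (\<lambda>g. F g + G g) (\<lambda>g. F' g + G' g)"
| cmult: "poly_deriv I \<alpha> F F' \<Longrightarrow> poly_deriv I \<alpha> (\<lambda>g. c * F g) (\<lambda>g. c * F' g)"

lemma gmonom_mult: "gmonom I n g * gmonom I m g = gmonom I (\<lambda>i. n i + m i) g"
  by (simp add: power_add prod.distrib)

text \<open>For \<open>n \<alpha> = 0\<close> truncated subtraction may break the equality of
  exponents, but then the coefficient is 0.\<close>

lemma gmonom_mult_deriv: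
  "real (n \<alpha>) * gmonom I (n(\<alpha> := n \<alpha> - 1)) g * gmonom I m g
     = real (n \<alpha>) * gmonom I ((\<lambda>i. n i + m i)(\<alpha> := n \<alpha> + m \<alpha> - 1)) g"
proof (cases "n \<alpha> = 0")
  case False
  then have "(\<lambda>i. (n(\<alpha> := n \<alpha> - 1)) i + m i) = (\<lambda>i. n i + m i)(\<alpha> := n \<alpha> + m \<alpha> - 1)" by auto
  then have "gmonom I (\<lambda>i. (n(\<alpha> := n \<alpha> - 1)) i + m i) g
      = gmonom I ((\<lambda>i. n i + m i)(\<alpha> := n \<alpha> + m \<alpha> - 1)) g" by metis
  then show ?thesis by (simp only: mult.assoc gmonom_mult)
qed simp

lemma poly_deriv_monom_mult:
  assumes "poly_deriv I \<alpha> G G'"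
  shows "poly_deriv I \<alpha> (\<lambda>g. gmonom I n g * G g)
    (\<lambda>g. real (n \<alpha>) * gmonom I (n(\<alpha> := n \<alpha> - 1)) g * G g + gmonom I n g * G' g)"
  using assms
proof (induction rule: poly_deriv.induct)
  case (monom m)
  have "poly_deriv I \<alpha> (gmonom I (\<lambda>i. n i + m i))
      (\<lambda>g. real (n \<alpha> + m \<alpha>) * gmonom I ((\<lambda>i. n i + m i)(\<alpha> := n \<alpha> + m \<alpha> - 1)) g)"
    using poly_deriv.monom[of I \<alpha> "\<lambda>i. n i + m i"] by simp
  moreover have "real (n \<alpha> + m \<alpha>) * gmonom I ((\<lambda>i. n i + m i)(\<alpha> := n \<alpha> + m \<alpha> - 1)) g
      = real (n \<alpha>) * gmonom I (n(\<alpha> := n \<alpha> - 1)) g * gmonom I m g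
        + gmonom I n g * (real (m \<alpha>) * gmonom I (m(\<alpha> := m \<alpha> - 1)) g)" for g
  proof -
    have swap: "(\<lambda>i. m i + n i)(\<alpha> := m \<alpha> + n \<alpha> - 1) = (\<lambda>i. n i + m i)(\<alpha> := n \<alpha> + m \<alpha> - 1)"
      by (simp add: add.commute)
    have "gmonom I n g * (real (m \<alpha>) * gmonom I (m(\<alpha> := m \<alpha> - 1)) g)
        = real (m \<alpha>) * gmonom I (m(\<alpha> := m \<alpha> - 1)) g * gmonom I n g"
      by (rule mult.commute)
    also have "\<dots> = real (m \<alpha>) * gmonom I ((\<lambda>i. n i + m i)(\<alpha> := n \<alpha> + m \<alpha> - 1)) g"
      by (simp only: gmonom_mult_deriv swap)
    finally show ?thesis by (simp only: gmonom_mult_deriv of_nat_add distrib_right)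
  qed
  ultimately show ?case by (simp only: gmonom_mult)
next
  case (add F F' G G')
  from poly_deriv.add[OF add.IH] show ?case by (simp add: algebra_simps)
next
  case (cmult F F' c)
  from poly_deriv.cmult[OF cmult.IH, of c] show ?case by (simp add: algebra_simps)
qed

lemma poly_deriv_mult:
  assumes "poly_deriv I \<alpha> F F'" "poly_deriv I \<alpha> G G'"
  shows "poly_deriv I \<alpha> (\<lambda>g. F g * G g) (\<lambda>g. F' g * G g + F g * G' g)"
  using assms(1)
proof (induction rule: poly_deriv.induct)
  case (monom n)
  show ?case by (rule poly_deriv_monom_mult[OF assms(2)])
next
  case (add F F' H H')
  from poly_deriv.add[OF add.IH] show ?case by (simp add: algebra_simps)
next
  case (cmult F F' c)
  from poly_deriv.cmult[OF cmult.IH, of c] show ?case by (simp add: algebra_simps)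
qed

lemma poly_deriv_const: "poly_deriv I \<alpha> (\<lambda>_. c) (\<lambda>_. 0)"
  using poly_deriv.cmult[OF poly_deriv.monom[of I \<alpha> "\<lambda>_. 0"], of c] by simp

lemma poly_deriv_coord:
  assumes "finite I" "\<beta> \<in> I"
  shows "poly_deriv I \<alpha> (\<lambda>g. g \<beta>) (\<lambda>_. if \<beta> = \<alpha> then 1 else 0)"
proof -
  let ?n = "\<lambda>i. if i = \<beta> then 1 else (0 :: nat)"
  have "gmonom I ?n = (\<lambda>g. g \<beta>)"
  proof
    fix g :: "'a \<Rightarrow> real"
    have "gmonom I ?n g = (\<Prod>i\<in>I. if i = \<beta> then g i else 1)" by (intro prod.cong) auto
    then show "gmonom I ?n g = g \<beta>" using assms by simp
  qed
  moreover have "(\<lambda>g. real (?n \<alpha>) * gmonom I (?n(\<alpha> := ?n \<alpha> - 1)) g) = (\<lambda>_. if \<beta> = \<alpha> then 1 else 0)"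
  proof
    fix g :: "'a \<Rightarrow> real"
    have "gmonom I (?n(\<beta> := 0)) g = 1" by (intro prod.neutral) auto
    then show "real (?n \<alpha>) * gmonom I (?n(\<alpha> := ?n \<alpha> - 1)) g = (if \<beta> = \<alpha> then 1 else 0)" by auto
  qed
  ultimately show ?thesis using poly_deriv.monom[of I \<alpha> ?n] by simp
qed

lemma poly_deriv_sum:
  "(\<And>i. i \<in> J \<Longrightarrow> poly_deriv I \<alpha> (F i) (F' i)) \<Longrightarrow>
     poly_deriv I \<alpha> (\<lambda>g. \<Sum>i\<in>J. F i g) (\<lambda>g. \<Sum>i\<in>J. F' i g)"
  by (induction J rule: infinite_finite_induct) (auto intro: poly_deriv.add poly_deriv_const)

text \<open>Both sides are linear in \<open>F\<close>, so monomials suffice; there the integral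
  factorises and \<open>std_moment_Suc\<close> treats the coordinate \<open>\<alpha>\<close>.
  Integrability is carried along because additivity of the integral requires it.\<close>

lemma gaussian_integration_by_parts:
  assumes I: "finite I" "\<alpha> \<in> I" and "poly_deriv I \<alpha> F F'"
  shows "integrable (gauss I) F \<and> integrable (gauss I) F' \<and> integrable (gauss I) (\<lambda>g. g \<alpha> * F g) \<and>
    (\<integral>g. g \<alpha> * F g \<partial>gauss I) = (\<integral>g. F' g \<partial>gauss I)"
  using assms(3)
proof (induction rule: poly_deriv.induct)
  case (monom n)
  have split: "(\<Prod>i\<in>I. f i ((n(\<alpha> := v)) i)) = f \<alpha> v * (\<Prod>i\<in>I - {\<alpha>}. f i (n i))"
    for f :: "'a \<Rightarrow> nat \<Rightarrow> real" and v
    using I by (subst prod.remove[of _ \<alpha>]) auto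
  have "(\<lambda>g. g \<alpha> * gmonom I n g) = gmonom I (n(\<alpha> := Suc (n \<alpha>)))"
    using I by (auto simp: fun_eq_iff split[of "\<lambda>i v. _ i ^ v"] prod.remove[of I \<alpha>])
  moreover have "(\<integral>g. gmonom I (n(\<alpha> := Suc (n \<alpha>))) g \<partial>gauss I)
      = (\<integral>g. real (n \<alpha>) * gmonom I (n(\<alpha> := n \<alpha> - 1)) g \<partial>gauss I)"
    using split[of "\<lambda>i v. std_moment v"] by (simp add: integral_gmonom[OF I(1)] std_moment_Suc del: power_Suc)
  ultimately show ?case using integrable_gmonom[OF I(1)] by simp
next
  case (add F F' G G')
  then show ?case by (simp add: distrib_left)
next
  case (cmult F F' c)
  then show ?case by (simp add: mult.left_commute[of _ c])
qed

text \<open>The Leibniz rule without commutativity: \<open>A\<close> replaces one of the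
  \<open>n\<close> factors, with \<open>q\<close> factors to its left.\<close>

lemma poly_deriv_mpow:
  assumes X: "\<And>i j. poly_deriv I \<alpha> (\<lambda>g. X g i j) (\<lambda>_. A i j)"
    and supp: "supp d A" "\<And>g. supp d (X g)"
  shows "poly_deriv I \<alpha> (\<lambda>g. mpow d (X g) n i j)
    (\<lambda>g. \<Sum>q<n. mm d (mpow d (X g) q) (mm d A (mpow d (X g) (n - 1 - q))) i j)"
proof (induction n arbitrary: i j)
  case 0
  show ?case by (simp add: poly_deriv_const)
next
  case (Suc n)
  have "poly_deriv I \<alpha> (\<lambda>g. \<Sum>l<d. X g i l * mpow d (X g) n l j)
     (\<lambda>g. \<Sum>l<d. A i l * mpow d (X g) n l j
        + X g i l * (\<Sum>q<n. mm d (mpow d (X g) q) (mm d A (mpow d (X g) (n - 1 - q))) l j))"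
    by (intro poly_deriv_sum poly_deriv_mult X Suc.IH)
  moreover have "(\<Sum>l<d. A i l * mpow d (X g) n l j
        + X g i l * (\<Sum>q<n. mm d (mpow d (X g) q) (mm d A (mpow d (X g) (n - 1 - q))) l j))
    = (\<Sum>q<Suc n. mm d (mpow d (X g) q) (mm d A (mpow d (X g) (Suc n - 1 - q))) i j)" for g
  proof -
    have "(\<Sum>q<Suc n. mm d (mpow d (X g) q) (mm d A (mpow d (X g) (Suc n - 1 - q))) i j)
      = mm d A (mpow d (X g) n) i j
        + (\<Sum>q<n. mm d (X g) (mm d (mpow d (X g) q) (mm d A (mpow d (X g) (n - 1 - q)))) i j)"
      unfolding sum.lessThan_Suc_shift
      by (simp add: mm_mid_left supp_mm supp_mpow supp mm_assoc)
    also have "(\<Sum>q<n. mm d (X g) (mm d (mpow d (X g) q) (mm d A (mpow d (X g) (n - 1 - q)))) i j)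
      = (\<Sum>l<d. X g i l * (\<Sum>q<n. mm d (mpow d (X g) q) (mm d A (mpow d (X g) (n - 1 - q))) l j))"
      unfolding mm_def[of d "X g"] sum_distrib_left by (rule sum.swap)
    finally show ?thesis by (simp add: mm_def[of d A] sum.distrib)
  qed
  ultimately show ?case by (simp add: mm_def[of d "X _"])
qed

text \<open>As the coefficients are symmetric, \<open>variance\<close> says that the sum of the
  squares of the \<open>A \<alpha>\<close> is at most \<open>s\<^sup>2\<close> times the
  identity.\<close>

locale gaussian_matrix =
  fixes I :: "'a set" and d :: nat and A :: "'a \<Rightarrow> rmat" and s :: real
  assumes finI: "finite I"
    and suppA: "\<And>\<alpha>. \<alpha> \<in> I \<Longrightarrow> supp d (A \<alpha>)"
    and symA: "\<And>\<alpha>. \<alpha> \<in> I \<Longrightarrow> sym_mat (A \<alpha>)"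
    and variance: "\<And>x. (\<Sum>\<alpha>\<in>I. \<Sum>i<d. (\<Sum>j<d. A \<alpha> i j * x j)\<^sup>2) \<le> s\<^sup>2 * normsq d x"
begin

definition X :: "('a \<Rightarrow> real) \<Rightarrow> rmat" where
  "X g = (\<lambda>i j. \<Sum>\<alpha>\<in>I. g \<alpha> * A \<alpha> i j)"

lemma suppX: "supp d (X g)"
  using suppA by (auto simp: supp_def X_def intro!: sum.neutral)

lemma symX: "sym_mat (X g)"
  using symA by (auto simp: sym_mat_def X_def intro!: sum.cong)

lemma poly_deriv_X: "\<alpha> \<in> I \<Longrightarrow> poly_deriv I \<alpha> (\<lambda>g. X g i j) (\<lambda>_. A \<alpha> i j)"
proof -
  assume \<alpha>: "\<alpha> \<in> I"
  have "poly_deriv I \<alpha> (\<lambda>g. \<Sum>\<beta>\<in>I. A \<beta> i j * g \<beta>)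
      (\<lambda>g. \<Sum>\<beta>\<in>I. A \<beta> i j * (if \<beta> = \<alpha> then 1 else 0))"
    by (intro poly_deriv_sum poly_deriv.cmult poly_deriv_coord finI)
  moreover have "(\<Sum>\<beta>\<in>I. A \<beta> i j * (if \<beta> = \<alpha> then 1 else 0)) = A \<alpha> i j"
    using \<alpha> finI by (simp add: if_distrib[of "\<lambda>x. _ * x"] cong: if_cong)
  ultimately show ?thesis by (simp add: X_def mult.commute)
qed

lemma poly_deriv_mpow_X:
  "\<alpha> \<in> I \<Longrightarrow> poly_deriv I \<alpha> (\<lambda>g. mpow d (X g) n i j)
    (\<lambda>g. \<Sum>q<n. mm d (mpow d (X g) q) (mm d (A \<alpha>) (mpow d (X g) (n - 1 - q))) i j)"
  by (intro poly_deriv_mpow poly_deriv_X suppA suppX)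

text \<open>One factor \<open>X g\<close> is expanded in the \<open>g \<alpha>\<close> and
  integrated by parts against the other \<open>2 * n + 1\<close>. Each resulting trace is bounded by
  a squared Frobenius norm through \<open>trace_interlace_le\<close>, and the sum over
  \<open>\<alpha>\<close> by the variance.\<close>

lemma trace_step:
  assumes "integrable (gauss I) (\<lambda>g. mtr d (mpow d (X g) (2 * n)))"
  shows "(\<integral>g. mtr d (mpow d (X g) (2 * n + 2)) \<partial>gauss I)
       \<le> real (2 * n + 1) * s\<^sup>2 * (\<integral>g. mtr d (mpow d (X g) (2 * n)) \<partial>gauss I)"
    "integrable (gauss I) (\<lambda>g. mtr d (mpow d (X g) (2 * n + 2)))"
proof -
  define W where "W = (\<lambda>\<alpha> g i j. \<Sum>q<2*n+1. mm d (mpow d (X g) q) (mm d (A \<alpha>) (mpow d (X g) (2 * n - q))) i j)"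
  let ?P = "\<lambda>g. mpow d (X g)"
  have ibp: "integrable (gauss I) (\<lambda>g. W \<alpha> g i j)" "integrable (gauss I) (\<lambda>g. g \<alpha> * ?P g (2 * n + 1) i j)"
    "(\<integral>g. g \<alpha> * ?P g (2 * n + 1) i j \<partial>gauss I) = (\<integral>g. W \<alpha> g i j \<partial>gauss I)"
    if "\<alpha> \<in> I" for \<alpha> i j
    using gaussian_integration_by_parts[OF finI that poly_deriv_mpow_X[OF that, of "2 * n + 1" i j]]
    by (simp_all add: W_def)
  have tr: "mtr d (?P g (2 * n + 2)) = (\<Sum>i<d. \<Sum>j<d. \<Sum>\<alpha>\<in>I. A \<alpha> i j * (g \<alpha> * ?P g (2 * n + 1) j i))" for g
  proof -
    have "?P g (2 * n + 2) = mm d (X g) (?P g (2 * n + 1))" by simp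
    then show ?thesis unfolding mtr_def mm_def
      by (simp add: X_def sum_distrib_right mult_ac)
  qed
  show int: "integrable (gauss I) (\<lambda>g. mtr d (mpow d (X g) (2 * n + 2)))"
    unfolding tr by (intro Bochner_Integration.integrable_sum integrable_mult_right ibp)
  have trW: "(\<Sum>i<d. \<Sum>j<d. A \<alpha> i j * W \<alpha> g j i)
      = (\<Sum>q<2*n+1. mtr d (mm d (A \<alpha>) (mm d (?P g q) (mm d (A \<alpha>) (?P g (2 * n - q))))))" for \<alpha> g
  proof -
    have "(\<Sum>i<d. \<Sum>j<d. A \<alpha> i j * W \<alpha> g j i) = (\<Sum>i<d. \<Sum>q<2*n+1. \<Sum>j<d. A \<alpha> i j *
        mm d (mpow d (X g) q) (mm d (A \<alpha>) (mpow d (X g) (2 * n - q))) j i)"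
      unfolding W_def sum_distrib_left by (intro sum.cong refl sum.swap)
    also have "\<dots> = (\<Sum>q<2*n+1. \<Sum>i<d. \<Sum>j<d. A \<alpha> i j *
        mm d (mpow d (X g) q) (mm d (A \<alpha>) (mpow d (X g) (2 * n - q))) j i)" by (rule sum.swap)
    finally show ?thesis unfolding mtr_def mm_def[of d "A \<alpha>" "mm d _ _"] .
  qed
  have bound: "(\<Sum>\<alpha>\<in>I. \<Sum>i<d. \<Sum>j<d. A \<alpha> i j * W \<alpha> g j i)
      \<le> real (2 * n + 1) * s\<^sup>2 * mtr d (?P g (2 * n))" for g
  proof -
    let ?C = "\<lambda>\<alpha>. mm d (A \<alpha>) (?P g n)"
    have "(\<Sum>\<alpha>\<in>I. \<Sum>i<d. \<Sum>j<d. A \<alpha> i j * W \<alpha> g j i) \<le> (\<Sum>\<alpha>\<in>I. \<Sum>q<2*n+1. fro d (?C \<alpha>) (?C \<alpha>))"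
      unfolding trW by (intro sum_mono trace_interlace_le suppX symX suppA symA) auto
    also have "\<dots> = real (2 * n + 1) * (\<Sum>\<alpha>\<in>I. \<Sum>i<d. \<Sum>j<d. (\<Sum>l<d. A \<alpha> i l * ?P g n l j)\<^sup>2)"
      by (simp add: fro_def mm_def power2_eq_square sum_distrib_left)
    \<comment> \<open>Columns are moved outermost, as the variance bound is applied to each column
      of \<open>?P g n\<close>.\<close>
    also have "(\<Sum>\<alpha>\<in>I. \<Sum>i<d. \<Sum>j<d. (\<Sum>l<d. A \<alpha> i l * ?P g n l j)\<^sup>2)
        = (\<Sum>\<alpha>\<in>I. \<Sum>j<d. \<Sum>i<d. (\<Sum>l<d. A \<alpha> i l * ?P g n l j)\<^sup>2)"
      by (intro sum.cong refl sum.swap)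
    also have "\<dots> = (\<Sum>j<d. \<Sum>\<alpha>\<in>I. \<Sum>i<d. (\<Sum>l<d. A \<alpha> i l * ?P g n l j)\<^sup>2)"
      by (rule sum.swap)
    also have "\<dots> \<le> (\<Sum>j<d. s\<^sup>2 * normsq d (\<lambda>l. ?P g n l j))"
      by (intro sum_mono variance)
    also have "\<dots> = s\<^sup>2 * (\<Sum>j<d. \<Sum>i<d. ?P g n i j * ?P g n i j)"
      by (simp add: power2_eq_square sum_distrib_left)
    also have "(\<Sum>j<d. \<Sum>i<d. ?P g n i j * ?P g n i j) = fro d (?P g n) (?P g n)"
      unfolding fro_def by (rule sum.swap)
    also have "\<dots> = mtr d (?P g (2 * n))" by (simp add: fro_mpow suppX symX)
    finally show ?thesis by (simp add: mult_left_mono mult.assoc)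
  qed
  have "(\<integral>g. mtr d (mpow d (X g) (2 * n + 2)) \<partial>gauss I)
      = (\<Sum>i<d. \<Sum>j<d. \<Sum>\<alpha>\<in>I. A \<alpha> i j * (\<integral>g. W \<alpha> g j i \<partial>gauss I))"
    unfolding tr using ibp by (simp add: Bochner_Integration.integral_sum)
  also have "\<dots> = (\<Sum>i<d. \<Sum>\<alpha>\<in>I. \<Sum>j<d. A \<alpha> i j * (\<integral>g. W \<alpha> g j i \<partial>gauss I))"
    by (intro sum.cong refl sum.swap)
  also have "\<dots> = (\<Sum>\<alpha>\<in>I. \<Sum>i<d. \<Sum>j<d. A \<alpha> i j * (\<integral>g. W \<alpha> g j i \<partial>gauss I))"
    by (rule sum.swap)
  also have "\<dots> = (\<integral>g. (\<Sum>\<alpha>\<in>I. \<Sum>i<d. \<Sum>j<d. A \<alpha> i j * W \<alpha> g j i) \<partial>gauss I)"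
    using ibp by (simp add: Bochner_Integration.integral_sum)
  also have "\<dots> \<le> (\<integral>g. real (2 * n + 1) * s\<^sup>2 * mtr d (?P g (2 * n)) \<partial>gauss I)"
    using assms ibp bound
    by (intro integral_mono Bochner_Integration.integrable_sum integrable_mult_right) auto
  finally show "(\<integral>g. mtr d (mpow d (X g) (2 * n + 2)) \<partial>gauss I)
       \<le> real (2 * n + 1) * s\<^sup>2 * (\<integral>g. mtr d (mpow d (X g) (2 * n)) \<partial>gauss I)" by simp
qed

lemma trace_nonneg: "0 \<le> mtr d (mpow d (X g) (2 * n))"
  unfolding fro_mpow[OF suppX symX, symmetric] fro_def by (intro sum_nonneg) auto

text \<open>Fixing \<open>p\<close> bounds every factor \<open>2 * n + 1\<close> of the recursion by
  \<open>2 * p\<close>; the recursion starts from the trace \<open>d\<close> of the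
  identity.\<close>

lemma trace_moment:
  assumes "n \<le> p"
  shows "integrable (gauss I) (\<lambda>g. mtr d (mpow d (X g) (2 * n))) \<and>
    (\<integral>g. mtr d (mpow d (X g) (2 * n)) \<partial>gauss I) \<le> real d * (2 * real p * s\<^sup>2) ^ n"
  using assms
proof (induction n)
  case 0
  interpret prob_space "gauss I" by (rule prob_space_gauss)
  show ?case by (simp add: mtr_def mid_def prob_space)
next
  case (Suc n)
  then have IH: "integrable (gauss I) (\<lambda>g. mtr d (mpow d (X g) (2 * n)))"
    "(\<integral>g. mtr d (mpow d (X g) (2 * n)) \<partial>gauss I) \<le> real d * (2 * real p * s\<^sup>2) ^ n" by auto
  have "(\<integral>g. mtr d (mpow d (X g) (2 * n + 2)) \<partial>gauss I)
       \<le> real (2 * n + 1) * s\<^sup>2 * (\<integral>g. mtr d (mpow d (X g) (2 * n)) \<partial>gauss I)"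
    by (rule trace_step(1)[OF IH(1)])
  also have "\<dots> \<le> (2 * real p * s\<^sup>2) * (real d * (2 * real p * s\<^sup>2) ^ n)"
    using Suc.prems
    by (intro mult_mono IH(2) integral_nonneg)
      (auto simp: trace_nonneg)
  finally show ?case using trace_step(2)[OF IH(1)] by (simp add: mult_ac)
qed

lemma trace_tail:
  assumes c: "0 < c" and s: "0 < s" and p: "0 < p"
  shows "measure (gauss I) {g \<in> space (gauss I). mtr d (mpow d (X g) (2 * p)) \<ge> (2 * real p * c * s\<^sup>2) ^ p}
       \<le> real d / c ^ p"
proof -
  have b: "0 < (2 * real p * c * s\<^sup>2) ^ p" using assms by simp
  have "measure (gauss I) {g \<in> space (gauss I). mtr d (mpow d (X g) (2 * p)) \<ge> (2 * real p * c * s\<^sup>2) ^ p}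
      \<le> (\<integral>g. mtr d (mpow d (X g) (2 * p)) \<partial>gauss I) / (2 * real p * c * s\<^sup>2) ^ p"
    using trace_moment[of p p] b
    by (intro integral_Markov_inequality_measure[where A = "{}"])
      (auto simp: trace_nonneg)
  also have "\<dots> \<le> (real d * (2 * real p * s\<^sup>2) ^ p) / (2 * real p * c * s\<^sup>2) ^ p"
    using trace_moment[of p p] b by (intro divide_right_mono) auto
  also have "\<dots> = real d / c ^ p" using assms by (simp add: power_mult_distrib field_simps)
  finally show ?thesis .
qed

end

section \<open>Translates of the Gaussian measure\<close>

text \<open>Expanding the square in the exponent of the translated density produces the exponential
  factor.\<close>

lemma std_normal_shift:
  assumes [measurable]: "A \<in> sets borel"
  shows "emeasure std_normal_distribution {x. x + c \<in> A}
    = (\<integral>\<^sup>+x. indicator A x * ennreal (exp (c * x - c\<^sup>2 / 2)) \<partial>std_normal_distribution)"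
proof -
  have "emeasure std_normal_distribution {x. x + c \<in> A}
      = (\<integral>\<^sup>+x. ennreal (std_normal_density x) * indicator A (x + c) \<partial>lborel)"
    by (subst emeasure_density) (auto intro!: nn_integral_cong split: split_indicator)
  also have "\<dots> = (\<integral>\<^sup>+x. ennreal (std_normal_density (x - c)) * indicator A x \<partial>lborel)"
    using nn_integral_real_affine[of "\<lambda>x. ennreal (std_normal_density (x - c)) * indicator A x" 1 c]
    by (simp add: add.commute)
  also have "\<dots> = (\<integral>\<^sup>+x. ennreal (std_normal_density x) *
      (indicator A x * ennreal (exp (c * x - c\<^sup>2 / 2))) \<partial>lborel)"
  proof (intro nn_integral_cong)
    fix x
    have "std_normal_density (x - c) = std_normal_density x * exp (c * x - c\<^sup>2 / 2)"
      by (simp add: std_normal_density_def mult_exp_exp power2_eq_square field_simps)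
    then show "ennreal (std_normal_density (x - c)) * indicator A x = ennreal (std_normal_density x) *
      (indicator A x * ennreal (exp (c * x - c\<^sup>2 / 2)))"
      by (simp add: ennreal_mult mult_ac)
  qed
  also have "\<dots> = (\<integral>\<^sup>+x. indicator A x * ennreal (exp (c * x - c\<^sup>2 / 2)) \<partial>std_normal_distribution)"
    by (subst nn_integral_density) auto
  finally show ?thesis .
qed

text \<open>Both sides agree on boxes with the product of the shifted one-dimensional laws
  \<open>Q i\<close>, and boxes determine a product measure.\<close>

lemma gauss_shift:
  fixes c :: "'a \<Rightarrow> real"
  assumes I: "finite I"
  defines "T \<equiv> (\<lambda>g. \<lambda>i\<in>I. g i + c i)"
  shows "distr (gauss I) (gauss I) T
    = density (gauss I) (\<lambda>g. \<Prod>i\<in>I. ennreal (exp (c i * g i - (c i)\<^sup>2 / 2)))"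
proof -
  define Q where "Q = (\<lambda>i. distr std_normal_distribution borel (\<lambda>x. x + c i))"
  have Q: "prob_space (Q i)" for i
    unfolding Q_def by (intro prob_space.prob_space_distr prob_space_std_normal) simp
  interpret Q: product_sigma_finite Q
    unfolding product_sigma_finite_def by (intro allI prob_space_imp_sigma_finite Q)
  have setsQ: "sets (Q i) = sets borel" for i by (simp add: Q_def)
  have sets: "sets (gauss I) = sets (PiM I Q)" by (intro sets_PiM_cong) (auto simp: Q_def)
  have emQ: "emeasure (Q i) A = emeasure std_normal_distribution {x. x + c i \<in> A}"
    if "A \<in> sets borel" for i A
    unfolding Q_def by (subst emeasure_distr) (use that in \<open>auto simp: vimage_def\<close>)
  have T [measurable]: "T \<in> measurable (gauss I) (gauss I)"
    unfolding T_def by (intro measurable_restrict) measurable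
  have "distr (gauss I) (gauss I) T = PiM I Q"
  proof (rule Q.PiM_eqI[OF I])
    fix A assume "\<And>i. i \<in> I \<Longrightarrow> A i \<in> sets (Q i)"
    then have A [measurable]: "\<And>i. i \<in> I \<Longrightarrow> A i \<in> sets borel" by (simp add: setsQ)
    have B: "{x. x + c i \<in> A i} \<in> sets borel" if "i \<in> I" for i
      using measurable_sets[of "\<lambda>x. x + c i" borel borel "A i"] A[OF that] by (simp add: vimage_def)
    have "emeasure (distr (gauss I) (gauss I) T) (PiE I A)
        = emeasure (gauss I) (T -` PiE I A \<inter> space (gauss I))"
      using A I by (intro emeasure_distr T sets_PiM_I_finite) auto
    also have "T -` PiE I A \<inter> space (gauss I) = (\<Pi>\<^sub>E i\<in>I. {x. x + c i \<in> A i})"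
      by (auto simp: T_def space_PiM PiE_iff extensional_def)
    also have "emeasure (gauss I) \<dots> = (\<Prod>i\<in>I. emeasure std_normal_distribution {x. x + c i \<in> A i})"
      using B I by (intro std_normal.emeasure_PiM) auto
    also have "\<dots> = (\<Prod>i\<in>I. emeasure (Q i) (A i))" by (intro prod.cong refl emQ[symmetric] A)
    finally show "emeasure (distr (gauss I) (gauss I) T) (PiE I A) = \<dots>" .
  qed (simp add: sets)
  also have "PiM I Q = density (gauss I) (\<lambda>g. \<Prod>i\<in>I. ennreal (exp (c i * g i - (c i)\<^sup>2 / 2)))"
  proof (rule Q.PiM_eqI[OF I, symmetric])
    fix A assume "\<And>i. i \<in> I \<Longrightarrow> A i \<in> sets (Q i)"
    then have A [measurable]: "\<And>i. i \<in> I \<Longrightarrow> A i \<in> sets borel" by (simp add: setsQ)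
    have "emeasure (density (gauss I) (\<lambda>g. \<Prod>i\<in>I. ennreal (exp (c i * g i - (c i)\<^sup>2 / 2)))) (PiE I A)
       = (\<integral>\<^sup>+g. (\<Prod>i\<in>I. ennreal (exp (c i * g i - (c i)\<^sup>2 / 2))) * indicator (PiE I A) g \<partial>gauss I)"
      using A I by (intro emeasure_density sets_PiM_I_finite) auto
    also have "\<dots> = (\<integral>\<^sup>+g. (\<Prod>i\<in>I. indicator (A i) (g i) * ennreal (exp (c i * g i - (c i)\<^sup>2 / 2))) \<partial>gauss I)"
    proof (intro nn_integral_cong)
      fix g assume "g \<in> space (gauss I)"
      then have "indicator (PiE I A) g = (\<Prod>i\<in>I. indicator (A i) (g i) :: ennreal)"
        using I by (auto simp: space_PiM PiE_iff indicator_def prod_eq_1_iff)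
      then show "(\<Prod>i\<in>I. ennreal (exp (c i * g i - (c i)\<^sup>2 / 2))) * indicator (PiE I A) g
          = (\<Prod>i\<in>I. indicator (A i) (g i) * ennreal (exp (c i * g i - (c i)\<^sup>2 / 2)))"
        by (simp add: prod.distrib mult.commute)
    qed
    also have "\<dots> = (\<Prod>i\<in>I. \<integral>\<^sup>+x. indicator (A i) x * ennreal (exp (c i * x - (c i)\<^sup>2 / 2)) \<partial>std_normal_distribution)"
      using A by (intro std_normal.product_nn_integral_prod I) auto
    also have "\<dots> = (\<Prod>i\<in>I. emeasure (Q i) (A i))"
      using A by (intro prod.cong refl) (simp add: emQ std_normal_shift)
    finally show "emeasure (density (gauss I) (\<lambda>g. \<Prod>i\<in>I. ennreal (exp (c i * g i - (c i)\<^sup>2 / 2)))) (PiE I A) = \<dots>" .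
  qed (simp add: sets)
  finally show ?thesis .
qed

text \<open>After the shift the linear functional is at most \<open>2 + \<tau>\<close>, and where
  this holds the density of the translate is at most
  \<open>exp (\<tau> * (2 + \<tau>) - \<tau>\<^sup>2 / 2)\<close>.\<close>

lemma gauss_shift_measure_le:
  fixes b :: "'a \<Rightarrow> real"
  assumes I: "finite I" and b: "(\<Sum>i\<in>I. (b i)\<^sup>2) = 1" and \<tau>: "0 \<le> \<tau>"
    and F: "F \<in> sets (gauss I)" and G: "G \<in> sets (gauss I)"
    and small: "\<And>g. g \<in> F \<Longrightarrow> (\<Sum>i\<in>I. b i * g i) \<le> 2"
    and shift: "\<And>g. g \<in> F \<Longrightarrow> (\<lambda>i\<in>I. g i + \<tau> * b i) \<in> G"
  shows "measure (gauss I) F \<le> exp (2 * \<tau> + \<tau>\<^sup>2 / 2) * measure (gauss I) G"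
proof -
  interpret prob_space "gauss I" by (rule prob_space_gauss)
  define T where "T = (\<lambda>g. \<lambda>i\<in>I. g i + \<tau> * b i)"
  define G' where "G' = {h \<in> G. (\<Sum>i\<in>I. b i * h i) \<le> 2 + \<tau>}"
  have T [measurable]: "T \<in> measurable (gauss I) (gauss I)"
    unfolding T_def by (intro measurable_restrict) measurable
  have G' [measurable]: "G' \<in> sets (gauss I)"
  proof -
    have "{h \<in> space (gauss I). (\<Sum>i\<in>I. b i * h i) \<le> 2 + \<tau>} \<in> sets (gauss I)" by measurable
    moreover have "G' = G \<inter> {h \<in> space (gauss I). (\<Sum>i\<in>I. b i * h i) \<le> 2 + \<tau>}"
      using sets.sets_into_space[OF G] by (auto simp: G'_def)
    ultimately show ?thesis using G by auto
  qed
  have TF: "T g \<in> G'" if "g \<in> F" for g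
  proof -
    have "(\<Sum>i\<in>I. b i * T g i) = (\<Sum>i\<in>I. b i * g i + \<tau> * (b i)\<^sup>2)"
      by (intro sum.cong) (auto simp: T_def power2_eq_square algebra_simps)
    also have "\<dots> = (\<Sum>i\<in>I. b i * g i) + \<tau>" by (simp add: sum.distrib b flip: sum_distrib_left)
    finally show ?thesis using small[OF that] shift[OF that] by (simp add: G'_def T_def)
  qed
  have "emeasure (gauss I) F \<le> emeasure (gauss I) (T -` G' \<inter> space (gauss I))"
    using TF sets.sets_into_space[OF F] by (intro emeasure_mono measurable_sets[OF T]) auto
  also have "\<dots> = emeasure (distr (gauss I) (gauss I) T) G'" by (simp add: emeasure_distr)
  also have "\<dots> = (\<integral>\<^sup>+g. (\<Prod>i\<in>I. ennreal (exp (\<tau> * b i * g i - (\<tau> * b i)\<^sup>2 / 2))) * indicator G' g \<partial>gauss I)"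
    unfolding T_def gauss_shift[OF I] by (intro emeasure_density) auto
  also have "\<dots> \<le> (\<integral>\<^sup>+g. ennreal (exp (2 * \<tau> + \<tau>\<^sup>2 / 2)) * indicator G' g \<partial>gauss I)"
  proof (intro nn_integral_mono)
    fix g assume "g \<in> space (gauss I)"
    show "(\<Prod>i\<in>I. ennreal (exp (\<tau> * b i * g i - (\<tau> * b i)\<^sup>2 / 2))) * indicator G' g
        \<le> ennreal (exp (2 * \<tau> + \<tau>\<^sup>2 / 2)) * indicator G' g"
    proof (cases "g \<in> G'")
      case True
      have "(\<Sum>i\<in>I. \<tau> * b i * g i - (\<tau> * b i)\<^sup>2 / 2) = \<tau> * (\<Sum>i\<in>I. b i * g i) - \<tau>\<^sup>2 / 2 * (\<Sum>i\<in>I. (b i)\<^sup>2)"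
        by (simp add: sum_subtractf sum_distrib_left power_mult_distrib mult_ac)
      also have "\<dots> \<le> \<tau> * (2 + \<tau>) - \<tau>\<^sup>2 / 2"
        using True \<tau> unfolding b by (intro diff_mono mult_left_mono) (auto simp: G'_def)
      also have "\<dots> = 2 * \<tau> + \<tau>\<^sup>2 / 2" by (simp add: power2_eq_square algebra_simps)
      finally show ?thesis
        using True I by (simp add: prod_ennreal flip: exp_sum)
    qed simp
  qed
  also have "\<dots> = ennreal (exp (2 * \<tau> + \<tau>\<^sup>2 / 2)) * emeasure (gauss I) G'"
    by (simp add: nn_integral_cmult)
  also have "\<dots> \<le> ennreal (exp (2 * \<tau> + \<tau>\<^sup>2 / 2)) * emeasure (gauss I) G"
    using G by (intro mult_left_mono emeasure_mono) (auto simp: G'_def)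
  finally show ?thesis by (simp add: emeasure_eq_measure flip: ennreal_mult')
qed

text \<open>Integration by parts shows that the linear functional has second moment 1; Markov's
  inequality for its square at level 4 does the rest.\<close>

lemma gauss_linear_tail:
  fixes b :: "'a \<Rightarrow> real"
  assumes I: "finite I" and b: "(\<Sum>i\<in>I. (b i)\<^sup>2) = 1"
  shows "measure (gauss I) {g \<in> space (gauss I). 2 < (\<Sum>i\<in>I. b i * g i)} \<le> 1/4"
proof -
  interpret prob_space "gauss I" by (rule prob_space_gauss)
  let ?L = "\<lambda>g. \<Sum>i\<in>I. b i * g i"
  have pd: "poly_deriv I \<alpha> ?L (\<lambda>_. b \<alpha>)" if "\<alpha> \<in> I" for \<alpha>
  proof -
    have "poly_deriv I \<alpha> ?L (\<lambda>_. \<Sum>i\<in>I. b i * (if i = \<alpha> then 1 else 0))"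
      by (intro poly_deriv_sum poly_deriv.cmult poly_deriv_coord I)
    moreover have "(\<Sum>i\<in>I. b i * (if i = \<alpha> then 1 else 0)) = b \<alpha>"
      using that I by (simp add: if_distrib[of "\<lambda>x. _ * x"] cong: if_cong)
    ultimately show ?thesis by simp
  qed
  note ibp = gaussian_integration_by_parts[OF I _ pd]
  have sq: "(?L g)\<^sup>2 = (\<Sum>i\<in>I. b i * (g i * ?L g))" for g
    by (simp add: power2_eq_square sum_distrib_right mult_ac)
  have int: "integrable (gauss I) (\<lambda>g. (?L g)\<^sup>2)"
    unfolding sq using ibp by (intro Bochner_Integration.integrable_sum integrable_mult_right) auto
  have "(\<integral>g. (?L g)\<^sup>2 \<partial>gauss I) = (\<Sum>i\<in>I. b i * b i)"
    unfolding sq using ibp by (subst Bochner_Integration.integral_sum) (auto simp: prob_space)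
  then have var: "(\<integral>g. (?L g)\<^sup>2 \<partial>gauss I) = 1" using b by (simp add: power2_eq_square)
  have "prob {g \<in> space (gauss I). 2 < ?L g} \<le> prob {g \<in> space (gauss I). (?L g)\<^sup>2 \<ge> 4}"
  proof (intro finite_measure_mono subsetI)
    fix g assume "g \<in> {g \<in> space (gauss I). 2 < ?L g}"
    then show "g \<in> {g \<in> space (gauss I). (?L g)\<^sup>2 \<ge> 4}"
      using power_mono[of 2 "?L g" 2] by auto
  qed measurable
  also have "\<dots> \<le> (\<integral>g. (?L g)\<^sup>2 \<partial>gauss I) / 4"
    by (intro integral_Markov_inequality_measure[where A = "{}"] int) auto
  finally show ?thesis by (simp add: var)
qed

section \<open>Perturbation of the top eigenvector\<close>

lemma sets_is_top_in_closed:
  assumes m: "\<And>i j. (\<lambda>g. m g (i, j)) \<in> borel_measurable M" and K: "closed K"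
  shows "{g \<in> space M. \<exists>x\<in>K. is_top d (m g) x} \<in> sets M"
proof -
  have "m \<in> borel_measurable M"
    by (rule measurable_coordinatewise_then_product) (use m in \<open>auto simp: split_paired_all\<close>)
  from measurable_sets[OF this borel_closed[OF closed_is_top[OF K, of d]]]
  show ?thesis by (simp add: vimage_def Int_def conj_commute)
qed

text \<open>The condition \<open>q x < c\<close> is not closed, so the failures of the universal
  clause are collected over the countably many closed sets \<open>L n\<close>. The flag
  \<open>P\<close> will say that the second moment is nonzero.\<close>

lemma sets_top_event:
  fixes a :: "nat \<Rightarrow> real"
  assumes m: "\<And>i j. (\<lambda>g. m g (i, j)) \<in> borel_measurable M"
  shows "{g \<in> space M. (\<exists>x. is_top d (m g) x \<and> c \<le> (\<Sum>i<d. a i * x i)\<^sup>2) \<and>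
     (P \<longrightarrow> (\<forall>x. is_top d (m g) x \<longrightarrow> c \<le> (\<Sum>i<d. a i * x i)\<^sup>2))} \<in> sets M"
proof -
  define q where "q = (\<lambda>x. (\<Sum>i<d. a i * x i)\<^sup>2)"
  define L where "L = (\<lambda>n. {x. q x \<le> c - inverse (real (Suc n))})"
  define S where "S = (\<lambda>K. {g \<in> space M. \<exists>x\<in>K. is_top d (m g) x})"
  have S: "S K \<in> sets M" if "closed K" for K
    unfolding S_def by (rule sets_is_top_in_closed[OF _ that]) (rule m)
  have "closed {x. c \<le> q x}" "closed (L n)" for n
    unfolding q_def L_def by (intro closed_Collect_le continuous_intros)+
  then have meas: "S {x. c \<le> q x} \<in> sets M" "(\<Union>n. S (L n)) \<in> sets M"
    by (auto intro: S)
  have "q x < c \<longleftrightarrow> (\<exists>n. x \<in> L n)" for x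
  proof
    assume "q x < c"
    then obtain n where "inverse (real (Suc n)) < c - q x"
      using reals_Archimedean[of "c - q x"] by auto
    then have "x \<in> L n" by (simp add: L_def)
    then show "\<exists>n. x \<in> L n" ..
  next
    assume "\<exists>n. x \<in> L n"
    then obtain n where "q x \<le> c - inverse (real (Suc n))" by (auto simp: L_def)
    moreover have "0 < inverse (real (Suc n))" by simp
    ultimately show "q x < c" by linarith
  qed
  then have "(\<forall>x. is_top d (m g) x \<longrightarrow> c \<le> q x) \<longleftrightarrow> \<not> (\<exists>n. \<exists>x\<in>L n. is_top d (m g) x)" for g
    by (meson not_le)
  then have "{g \<in> space M. (\<exists>x. is_top d (m g) x \<and> c \<le> q x) \<and>
     (P \<longrightarrow> (\<forall>x. is_top d (m g) x \<longrightarrow> c \<le> q x))} = S {x. c \<le> q x} - (if P then (\<Union>n. S (L n)) else {})"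
    unfolding S_def by auto
  then show ?thesis using meas by (simp add: q_def)
qed

section \<open>Bounds for the spectral norm\<close>

lemma mult_mat_vec_fun: "mat d d f *\<^sub>v vec d x = vec d (\<lambda>i. \<Sum>j<d. f (i, j) * x j)"
  by (auto simp: vec_eq_iff scalar_prod_def atLeast0LessThan)

lemma normsq_mat_mult_le:
  "normsq d (\<lambda>i. \<Sum>j<d. f (i, j) * x j) \<le> (\<Sum>i<d. \<Sum>j<d. (f (i, j))\<^sup>2) * normsq d x"
  unfolding sum_distrib_right[of _ "{..<d}" "normsq d x"]
  by (intro sum_mono order_trans[OF Cauchy_Schwarz_ineq_sum]) (simp add: sum_distrib_right)

lemma spectral_norm_ge:
  assumes "normsq d x \<le> 1"
  shows "sqrt (normsq d (\<lambda>i. \<Sum>j<d. f (i, j) * x j)) \<le> spectral_norm (mat d d f)"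
  unfolding spectral_norm_def
proof (rule cSup_upper)
  show "sqrt (normsq d (\<lambda>i. \<Sum>j<d. f (i, j) * x j))
     \<in> {vnorm (mat d d f *\<^sub>v v) |v. v \<in> carrier_vec (dim_col (mat d d f)) \<and> vnorm v \<le> 1}"
    using assms by (intro CollectI exI[of _ "vec d x"]) (simp add: mult_mat_vec_fun vnorm_vec)
  \<comment> \<open>The supremum is meaningful only for a bounded set; the Frobenius norm serves as
    the bound.\<close>
  show "bdd_above {vnorm (mat d d f *\<^sub>v v) |v. v \<in> carrier_vec (dim_col (mat d d f)) \<and> vnorm v \<le> 1}"
  proof (rule bdd_aboveI)
    fix y assume "y \<in> {vnorm (mat d d f *\<^sub>v v) |v. v \<in> carrier_vec (dim_col (mat d d f)) \<and> vnorm v \<le> 1}"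
    then obtain v where v: "y = vnorm (mat d d f *\<^sub>v v)" "v \<in> carrier_vec d" "vnorm v \<le> 1" by auto
    then obtain z where z: "v = vec d z" using vec_as_fun by blast
    have "normsq d (\<lambda>i. \<Sum>j<d. f (i, j) * z j) \<le> (\<Sum>i<d. \<Sum>j<d. (f (i, j))\<^sup>2) * normsq d z"
      by (rule normsq_mat_mult_le)
    also have "\<dots> \<le> (\<Sum>i<d. \<Sum>j<d. (f (i, j))\<^sup>2) * 1"
      using v(3) by (intro mult_left_mono sum_nonneg) (auto simp: z vnorm_vec)
    finally show "y \<le> sqrt (\<Sum>i<d. \<Sum>j<d. (f (i, j))\<^sup>2)"
      by (simp add: v(1) z mult_mat_vec_fun vnorm_vec)
  qed
qed

lemma spectral_norm_nonneg: "0 \<le> spectral_norm (mat d d f)"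
  using spectral_norm_ge[where d = d and x = "\<lambda>_. 0" and f = f] by simp

lemma spectral_norm_bound:
  "normsq d (\<lambda>i. \<Sum>j<d. f (i, j) * x j) \<le> (spectral_norm (mat d d f))\<^sup>2 * normsq d x"
proof (cases "normsq d x = 0")
  case True
  then show ?thesis using normsq_mat_mult_le[where d = d and x = x and f = f] by simp
next
  case False
  define n where "n = sqrt (normsq d x)"
  have n2: "n\<^sup>2 = normsq d x" by (simp add: n_def sum_nonneg)
  have n: "n \<noteq> 0" using False by (simp add: n_def)
  define w where "w = (\<lambda>i. x i / n)"
  have "normsq d w = 1"
    using n by (simp add: w_def power_divide flip: sum_divide_distrib n2)
  then have "sqrt (normsq d (\<lambda>i. \<Sum>j<d. f (i, j) * w j)) \<le> spectral_norm (mat d d f)"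
    by (intro spectral_norm_ge) simp
  then have "normsq d (\<lambda>i. \<Sum>j<d. f (i, j) * w j) \<le> (spectral_norm (mat d d f))\<^sup>2"
    using power_mono[of "sqrt (normsq d (\<lambda>i. \<Sum>j<d. f (i, j) * w j))" "spectral_norm (mat d d f)" 2]
    by (simp add: sum_nonneg)
  also have "normsq d (\<lambda>i. \<Sum>j<d. f (i, j) * w j) = normsq d (\<lambda>i. \<Sum>j<d. f (i, j) * x j) / n\<^sup>2"
    by (simp add: w_def power_divide flip: sum_divide_distrib)
  finally show ?thesis using n by (simp add: field_simps flip: n2)
qed

lemma spectral_norm_pos:
  assumes "mat d d f \<noteq> 0\<^sub>m d d" shows "0 < spectral_norm (mat d d f)"
proof (rule ccontr)
  assume "\<not> 0 < spectral_norm (mat d d f)"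
  then have s: "spectral_norm (mat d d f) = 0" using spectral_norm_nonneg[of d f] by simp
  have "f (i, j) = 0" if "i < d" "j < d" for i j
  proof -
    let ?e = "\<lambda>l. if l = j then 1 else 0 :: real"
    have "(\<Sum>l<d. f (r, l) * ?e l) = f (r, j)" for r
      using that by (simp add: if_distrib[of "\<lambda>x. _ * x"] cong: if_cong)
    then have "normsq d (\<lambda>i. f (i, j)) \<le> 0" using spectral_norm_bound[where d = d and x = ?e and f = f] s by simp
    moreover have "(f (i, j))\<^sup>2 \<le> normsq d (\<lambda>i. f (i, j))"
      by (rule member_le_sum) (use that in auto)
    ultimately have "(f (i, j))\<^sup>2 \<le> 0" by linarith
    then show ?thesis by simp
  qed
  then have "mat d d f = 0\<^sub>m d d" by auto
  then show False using assms by simp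
qed

section \<open>Moment matrices of the pseudo-distribution\<close>

context ball_pseudo_distribution
begin

text \<open>Padding with zeros provides the condition \<open>supp\<close> of the matrix
  calculus.\<close>

definition moment_matrix :: "nat \<Rightarrow> (nat \<Rightarrow> nat) \<Rightarrow> rmat" where
  "moment_matrix k \<alpha> = (\<lambda>i j. if i < d \<and> j < d then tensor_moment k \<alpha> i j else 0)"

lemma contracted_moment_eq:
  "contracted_moment d k D g = mat d d (\<lambda>(i, j). \<Sum>\<alpha>\<in>tensor_index d k. g \<alpha> * moment_matrix k \<alpha> i j)"
  unfolding contracted_moment_def pseudo_expectation_mat_def
proof (rule cong_mat[OF refl refl])
  fix i j assume ij: "i < d" "j < d"
  have "E (\<lambda>u. (tensor_inner d k g (tensor_power k u) \<cdot>\<^sub>m outer_self u) $$ (i, j))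
      = E (\<lambda>u. \<Sum>\<alpha>\<in>tensor_index d k. g \<alpha> * (tensor_power k u \<alpha> * (u $ i * u $ j)))"
    using ij by (intro E_cong) (auto simp: outer_self_def tensor_inner_def sum_distrib_right mult.assoc)
  also have "\<dots> = (\<Sum>\<alpha>\<in>tensor_index d k. g \<alpha> * moment_matrix k \<alpha> i j)"
    using ij by (simp add: E_sum E_cmult tensor_moment_def moment_matrix_def)
  finally show "(case (i, j) of (i, j) \<Rightarrow> E (\<lambda>u. (tensor_inner d k g (tensor_power k u) \<cdot>\<^sub>m outer_self u) $$ (i, j)))
      = (case (i, j) of (i, j) \<Rightarrow> \<Sum>\<alpha>\<in>tensor_index d k. g \<alpha> * moment_matrix k \<alpha> i j)" by simp
qed

lemma second_moment_eq: "second_moment d D = mat d d (\<lambda>(i, j). E (\<lambda>u. u $ i * u $ j))"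
  unfolding second_moment_def pseudo_expectation_mat_def
  by (intro eq_matI) (auto intro!: E_cong simp: outer_self_def)

lemma second_moment_form:
  "E (\<lambda>u. (lin d x u)\<^sup>2) = (\<Sum>i<d. x i * (\<Sum>j<d. E (\<lambda>u. u $ i * u $ j) * x j))"
proof -
  have "E (\<lambda>u. (lin d x u)\<^sup>2) = E (\<lambda>u. \<Sum>i<d. \<Sum>j<d. (x i * x j) * (u $ i * u $ j))"
    by (simp add: power2_eq_square sum_product mult_ac)
  also have "\<dots> = (\<Sum>i<d. \<Sum>j<d. (x i * x j) * E (\<lambda>u. u $ i * u $ j))"
    by (simp only: E_sum E_cmult)
  finally show ?thesis by (simp add: sum_distrib_left mult_ac)
qed

lemma second_moment_le_spectral:
  "E (\<lambda>u. (lin d x u)\<^sup>2) \<le> spectral_norm (second_moment d D) * normsq d x"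
proof -
  let ?s = "spectral_norm (second_moment d D)"
  let ?y = "\<lambda>i. \<Sum>j<d. E (\<lambda>u. u $ i * u $ j) * x j"
  have s: "0 \<le> ?s" unfolding second_moment_eq by (rule spectral_norm_nonneg)
  have "(E (\<lambda>u. (lin d x u)\<^sup>2))\<^sup>2 \<le> normsq d x * normsq d ?y"
    unfolding second_moment_form by (rule Cauchy_Schwarz_ineq_sum)
  also have "\<dots> \<le> normsq d x * (?s\<^sup>2 * normsq d x)"
    using spectral_norm_bound[where d = d and x = x and f = "\<lambda>(i, j). E (\<lambda>u. u $ i * u $ j)"]
    by (intro mult_left_mono) (auto simp: second_moment_eq sum_nonneg)
  also have "\<dots> = (?s * normsq d x)\<^sup>2" by (simp add: power2_eq_square mult_ac)
  finally show ?thesis by (rule power2_le_imp_le) (use s in \<open>auto intro!: mult_nonneg_nonneg sum_nonneg\<close>)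
qed

lemma tensor_power_inner:
  "(\<Sum>\<alpha>\<in>tensor_index d k. tensor_power k (vec d a) \<alpha> * tensor_power k u \<alpha>) = lin d a u ^ k"
proof -
  have "lin d a u ^ k = (\<Prod>j\<in>{..<k}. \<Sum>i\<in>{..<d}. vec d a $ i * u $ i)" by simp
  also have "\<dots> = (\<Sum>p\<in>{..<k} \<rightarrow>\<^sub>E {..<d}. \<Prod>j\<in>{..<k}. vec d a $ p j * u $ p j)"
    by (rule prod_sum_PiE) auto
  finally show ?thesis by (simp add: tensor_index_def tensor_power_def prod.distrib)
qed

text \<open>Contraction with the tensor power of \<open>a\<close> gives the matrix that a shift of
  \<open>g\<close> adds; its quadratic form is the signal.\<close>

lemma mqf_signal:
  "mqf d (\<lambda>i j. \<Sum>\<alpha>\<in>tensor_index d k. tensor_power k (vec d a) \<alpha> * moment_matrix k \<alpha> i j) x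
    = E (\<lambda>u. lin d a u ^ k * (lin d x u)\<^sup>2)"
proof -
  have entry: "(\<Sum>\<alpha>\<in>tensor_index d k. tensor_power k (vec d a) \<alpha> * moment_matrix k \<alpha> i j)
      = E (\<lambda>u. lin d a u ^ k * (u $ i * u $ j))" if "i < d" "j < d" for i j
    using that
    by (simp add: moment_matrix_def tensor_moment_def sum_distrib_right mult.assoc
        flip: E_sum E_cmult tensor_power_inner)
  have "mqf d (\<lambda>i j. \<Sum>\<alpha>\<in>tensor_index d k. tensor_power k (vec d a) \<alpha> * moment_matrix k \<alpha> i j) x
     = (\<Sum>i<d. \<Sum>j<d. (x i * x j) * E (\<lambda>u. lin d a u ^ k * (u $ i * u $ j)))"
    by (simp add: mqf_def entry sum_distrib_left mult_ac)
  also have "\<dots> = E (\<lambda>u. \<Sum>i<d. \<Sum>j<d. (x i * x j) * (lin d a u ^ k * (u $ i * u $ j)))"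
    by (simp only: E_sum E_cmult)
  also have "(\<lambda>u. \<Sum>i<d. \<Sum>j<d. (x i * x j) * (lin d a u ^ k * (u $ i * u $ j)))
      = (\<lambda>u. lin d a u ^ k * (lin d x u)\<^sup>2)"
    by (simp add: power2_eq_square sum_product sum_distrib_left mult_ac)
  finally show ?thesis .
qed

end

context bounded_second_moment
begin

lemma gaussian_moment_matrix:
  assumes "2 * (2 * k + 2) \<le> t"
  shows "gaussian_matrix (tensor_index d k) d (moment_matrix k) \<sigma>"
proof
  show "(\<Sum>\<alpha>\<in>tensor_index d k. \<Sum>i<d. (\<Sum>j<d. moment_matrix k \<alpha> i j * x j)\<^sup>2) \<le> \<sigma>\<^sup>2 * normsq d x" for x
    using tensor_moment_variance[OF assms, of x] by (simp add: moment_matrix_def)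
qed (auto simp: finite_tensor_index supp_def sym_mat_def moment_matrix_def tensor_moment_def mult_ac)

text \<open>A single entry is one summand of the variance at a basis vector. This is meant for
  arbitrarily small \<open>\<sigma>\<close>.\<close>

lemma tensor_moment_square_le:
  assumes "2 * (2 * k + 2) \<le> t" "\<alpha> \<in> tensor_index d k" "i < d" "j < d"
  shows "(tensor_moment k \<alpha> i j)\<^sup>2 \<le> \<sigma>\<^sup>2"
proof -
  let ?e = "\<lambda>l. if l = j then 1 else 0 :: real"
  have e: "(\<Sum>l<d. tensor_moment k \<beta> r l * ?e l) = tensor_moment k \<beta> r j" for \<beta> r
    using assms(4) by (simp add: if_distrib[of "\<lambda>x. _ * x"] cong: if_cong)
  have "(tensor_moment k \<alpha> i j)\<^sup>2 \<le> normsq d (\<lambda>r. tensor_moment k \<alpha> r j)"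
    by (rule member_le_sum) (use assms in auto)
  also have "\<dots> \<le> (\<Sum>\<beta>\<in>tensor_index d k. normsq d (\<lambda>r. tensor_moment k \<beta> r j))"
    by (rule member_le_sum) (use assms finite_tensor_index in \<open>auto intro: sum_nonneg\<close>)
  also have "\<dots> \<le> \<sigma>\<^sup>2 * normsq d ?e" using tensor_moment_variance[OF assms(1), of ?e] by (simp add: e)
  also have "normsq d ?e = 1" using assms(4) by (simp add: if_distrib[of "\<lambda>x. x\<^sup>2"] cong: if_cong)
  finally show ?thesis by simp
qed

text \<open>Write \<open>v = c a + y\<close> with \<open>y\<close> orthogonal to \<open>a\<close>, \<open>\<mu> = E \<langle>a, u\<rangle>\<^sup>k\<^sup>+\<^sup>2\<close> and
  \<open>Q x = E \<langle>a, u\<rangle>\<^sup>k \<langle>x, u\<rangle>\<^sup>2\<close>. Then \<open>Q y \<le> \<epsilon> \<mu> |y|\<^sup>2\<close>, which bounds \<open>Q v\<close> by about \<open>\<mu> (1 + c\<^sup>2) / 2\<close>,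
  while the comparison with \<open>a\<close> forces \<open>Q v \<ge> (1 - 2 \<epsilon>) \<mu>\<close>.\<close>

lemma maximiser_close:
  fixes N :: "(nat \<Rightarrow> real) \<Rightarrow> real"
  assumes a: "normsq d a = 1" and v: "normsq d v = 1" and k: "0 < k" "even k" and deg: "2 * k + 6 \<le> t"
    and \<epsilon>: "0 < \<epsilon>" and \<mu>: "2 * \<sigma> \<le> \<epsilon> * real k * E (\<lambda>u. lin d a u ^ (k + 2))"
    and \<tau>: "0 < \<tau>" and N: "\<And>x. normsq d x = 1 \<Longrightarrow> \<bar>N x\<bar> \<le> \<epsilon> * \<tau> * E (\<lambda>u. lin d a u ^ (k + 2))"
    and max: "\<tau> * E (\<lambda>u. lin d a u ^ k * (lin d a u)\<^sup>2) + N a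
       \<le> \<tau> * E (\<lambda>u. lin d a u ^ k * (lin d v u)\<^sup>2) + N v"
  shows "(\<Sum>i<d. a i * v i)\<^sup>2 \<ge> 1 - 8 * \<epsilon>"
proof -
  define \<mu> where "\<mu> = E (\<lambda>u. lin d a u ^ (k + 2))"
  define Q where "Q = (\<lambda>x. E (\<lambda>u. lin d a u ^ k * (lin d x u)\<^sup>2))"
  define c where "c = (\<Sum>i<d. a i * v i)"
  define y where "y = (\<lambda>i. v i - c * a i)"
  have Qa: "Q a = \<mu>" by (simp add: Q_def \<mu>_def power2_eq_square mult_ac)
  have pos: "0 < \<mu>"
  proof -
    have "0 < \<epsilon> * real k * \<mu>" using \<mu> sigma_pos by (simp add: \<mu>_def)
    then show ?thesis by (rule zero_less_mult_pos) (use \<epsilon> k in simp)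
  qed
  have ay: "(\<Sum>i<d. a i * y i) = 0"
  proof -
    have "(\<Sum>i<d. a i * y i) = (\<Sum>i<d. a i * v i - c * (a i)\<^sup>2)"
      by (intro sum.cong refl) (simp add: y_def power2_eq_square algebra_simps)
    also have "\<dots> = (\<Sum>i<d. a i * v i) - c * normsq d a"
      by (simp only: sum_subtractf sum_distrib_left)
    finally show ?thesis by (simp add: a c_def)
  qed
  have ny: "normsq d y = 1 - c\<^sup>2"
  proof -
    have "normsq d y = (\<Sum>i<d. (v i)\<^sup>2 - 2 * c * (a i * v i) + c\<^sup>2 * (a i)\<^sup>2)"
      by (intro sum.cong refl) (simp add: y_def power2_eq_square algebra_simps)
    also have "\<dots> = normsq d v - 2 * c * (\<Sum>i<d. a i * v i) + c\<^sup>2 * normsq d a"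
      by (simp only: sum_subtractf sum.distrib sum_distrib_left)
    finally show ?thesis unfolding a v c_def[symmetric] by (simp add: power2_eq_square)
  qed
  then have c1: "c\<^sup>2 \<le> 1" using sum_nonneg[of "{..<d}" "\<lambda>i. (y i)\<^sup>2"] by simp
  have Qy: "Q y \<le> \<epsilon> * \<mu> * (1 - c\<^sup>2)"
  proof -
    have "real k * Q y \<le> 2 * \<sigma> * normsq d y"
      unfolding Q_def by (rule orthogonal_moment[OF a ay k deg])
    also have "\<dots> \<le> \<epsilon> * real k * \<mu> * (1 - c\<^sup>2)"
      unfolding ny using \<mu> c1 by (intro mult_right_mono) (auto simp: \<mu>_def)
    finally have "real k * Q y \<le> real k * (\<epsilon> * \<mu> * (1 - c\<^sup>2))" by (simp add: mult_ac)
    then show ?thesis using k by simp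
  qed
  have linv: "lin d v u = c * lin d a u + lin d y u" for u
    by (simp add: y_def sum_distrib_left algebra_simps flip: sum.distrib)
  \<comment> \<open>The mixed term is split with weight \<open>2 * \<epsilon>\<close>, so that the
    bound on \<open>Q y\<close> turns the factor \<open>1 / (2 * \<epsilon>)\<close> into the
    constant \<open>1 / 2\<close>.\<close>
  have Qv: "Q v \<le> c\<^sup>2 * \<mu> + 2 * \<epsilon> * c\<^sup>2 * \<mu> + (1 / (2 * \<epsilon>) + 1) * Q y"
  proof -
    have "sosfun d (k div 2 + 1) (\<lambda>u. lin d a u ^ k * (2 * \<epsilon> * c * lin d a u - lin d y u)\<^sup>2)"
      by (intro sosfun_mult sosfun_even_power polyfun_lin k sosfun_square polyfun_diff polyfun_cmult)
    then have "0 \<le> E (\<lambda>u. lin d a u ^ k * (2 * \<epsilon> * c * lin d a u - lin d y u)\<^sup>2)"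
      using deg k by (intro E_sos) auto
    then have "0 \<le> (1 / (2 * \<epsilon>)) * E (\<lambda>u. lin d a u ^ k * (2 * \<epsilon> * c * lin d a u - lin d y u)\<^sup>2)"
      using \<epsilon> by simp
    also have "\<dots> = E (\<lambda>u. (c\<^sup>2 + 2 * \<epsilon> * c\<^sup>2) * (lin d a u ^ k * (lin d a u)\<^sup>2)
        + (1 / (2 * \<epsilon>) + 1) * (lin d a u ^ k * (lin d y u)\<^sup>2) - lin d a u ^ k * (lin d v u)\<^sup>2)"
      unfolding E_cmult[symmetric] linv using \<epsilon>
      by (intro arg_cong[where f = E] ext) (simp add: power2_eq_square field_simps)
    also have "\<dots> = (c\<^sup>2 + 2 * \<epsilon> * c\<^sup>2) * Q a + (1 / (2 * \<epsilon>) + 1) * Q y - Q v"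
      unfolding Q_def E_add E_diff E_cmult ..
    finally show ?thesis by (simp add: Qa algebra_simps)
  qed
  \<comment> \<open>The noise at \<open>a\<close> and the noise at \<open>v\<close> cost
    \<open>\<epsilon> * \<tau> * \<mu>\<close> each.\<close>
  have "\<tau> * ((1 - 2 * \<epsilon>) * \<mu>) \<le> \<tau> * Q v"
  proof -
    have "\<tau> * \<mu> + N a \<le> \<tau> * Q v + N v" using max by (simp flip: Qa add: Q_def)
    then show ?thesis using N[OF a] N[OF v] unfolding \<mu>_def[symmetric]
      by (simp add: algebra_simps abs_le_iff)
  qed
  then have "(1 - 2 * \<epsilon>) * \<mu> \<le> Q v" using \<tau> by simp
  also have "\<dots> \<le> c\<^sup>2 * \<mu> + 2 * \<epsilon> * c\<^sup>2 * \<mu> + (1 / (2 * \<epsilon>) + 1) * (\<epsilon> * \<mu> * (1 - c\<^sup>2))"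
    using Qv Qy \<epsilon> by (intro order_trans[OF Qv] add_left_mono mult_left_mono) auto
  also have "\<dots> = \<mu> * ((1 + c\<^sup>2) / 2 + \<epsilon> * (1 + c\<^sup>2))"
    using \<epsilon> by (simp add: field_simps)
  finally have "\<mu> * (1 - 2 * \<epsilon>) \<le> \<mu> * ((1 + c\<^sup>2) / 2 + \<epsilon> * (1 + c\<^sup>2))" by (simp add: mult.commute)
  then have "1 - 2 * \<epsilon> \<le> (1 + c\<^sup>2) / 2 + \<epsilon> * (1 + c\<^sup>2)" using pos by simp
  \<comment> \<open>What remains is
    \<open>2 - 4 * \<epsilon> \<le> 1 + c\<^sup>2 + 4 * \<epsilon>\<close>, the source of the
    constant 8.\<close>
  also have "\<epsilon> * (1 + c\<^sup>2) \<le> \<epsilon> * 2" using c1 \<epsilon> by (intro mult_left_mono) auto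
  finally show ?thesis unfolding c_def[symmetric] by (simp add: field_simps)
qed

end

section \<open>The main theorem\<close>

text \<open>Supplies the exponent of the trace bound, a power of two of order \<open>ln d\<close>.
  The hypothesis covers the case \<open>s = 0\<close>.\<close>

lemma power_of_two_between:
  fixes y :: real
  assumes "1 / 2 \<le> y" shows "\<exists>s. y \<le> 2 ^ s \<and> 2 ^ s \<le> 2 * y"
proof -
  define s where "s = (LEAST s. y \<le> 2 ^ s)"
  have "\<exists>s. y \<le> 2 ^ s" using real_arch_pow[of 2 y] by (auto intro: less_imp_le)
  then have "y \<le> 2 ^ s" unfolding s_def by (rule LeastI_ex)
  moreover have "2 ^ s \<le> 2 * y"
  proof (cases s)
    case 0 then show ?thesis using assms by simp
  next
    case (Suc r)
    then have "\<not> y \<le> 2 ^ r" unfolding s_def by (intro not_less_Least) simp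
    then show ?thesis using Suc by simp
  qed
  ultimately show ?thesis by blast
qed

lemma qform_mqf: "qform d (\<lambda>(i, j). Y i j) x = mqf d Y x"
  by (simp add: qform_def mqf_def sum_distrib_left mult_ac)

context bounded_second_moment
begin

text \<open>The set \<open>F\<close> consists of tensors with small noise and no large component
  along the tensor power of \<open>a\<close>. Its translate by \<open>\<tau>\<close> times that
  power lies in \<open>G\<close>, and \<open>gauss_shift_measure_le\<close> compares the
  measures.\<close>

lemma top_event_probability:
  assumes d: "2 \<le> d" and k: "0 < k" "even k" and deg: "6 * k \<le> t" and \<epsilon>: "0 < \<epsilon>"
    and a: "normsq d a = 1"
    and signal: "2 * exp (3 / 2) / (\<epsilon> * sqrt (real k)) * \<sigma> \<le> E (\<lambda>u. lin d a u ^ (k + 2))"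
    and G: "G \<in> sets (gaussian_tensor d k)"
    and good: "\<And>g. g \<in> space (gaussian_tensor d k) \<Longrightarrow>
      (\<And>x. is_top d (\<lambda>(i, j). \<Sum>\<alpha>\<in>tensor_index d k. g \<alpha> * moment_matrix k \<alpha> i j) x \<Longrightarrow>
         1 - 8 * \<epsilon> \<le> (\<Sum>i<d. a i * x i)\<^sup>2) \<Longrightarrow> g \<in> G"
  shows "1 / real d powr (3 * real k) \<le> measure (gaussian_tensor d k) G"
proof -
  let ?I = "tensor_index d k"
  have k2: "2 \<le> k" using k by (auto elim!: evenE)
  \<comment> \<open>From \<open>k \<ge> 2\<close> on, both degrees are at most
    \<open>6 * k\<close>.\<close>
  have deg': "2 * (2 * k + 2) \<le> t" "2 * k + 6 \<le> t" using deg k2 by auto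
  interpret gaussian_matrix ?I d "moment_matrix k" \<sigma> by (rule gaussian_moment_matrix[OF deg'(1)])
  interpret prob_space "gauss ?I" by (rule prob_space_gauss)
  define l where "l = ln (real d)"
  have expl: "exp l = real d" using d by (simp add: l_def)
  have l2: "ln 2 \<le> l" using d by (simp add: l_def)
  then have l: "2 / 3 \<le> l" using ln2_ge_two_thirds by linarith
  obtain s where s: "l \<le> 2 ^ s" "2 ^ s \<le> 2 * l" using power_of_two_between[of l] l by auto
  define p :: nat where "p = 2 ^ s"
  have p: "0 < p" "l \<le> real p" "real p \<le> 2 * l" using s by (simp_all add: p_def)
  \<comment> \<open>With \<open>exp 3\<close> as the constant \<open>c\<close> of
    \<open>trace_tail\<close>, the bound \<open>d / c ^ p\<close> is at most
    \<open>1 / d ^ 2\<close>, as \<open>p\<close> is at least \<open>ln d\<close>.\<close>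
  define B where "B = (2 * real p * exp 3 * \<sigma>\<^sup>2) ^ p"
  define b where "b = tensor_power k (vec d a)"
  define \<tau> where "\<tau> = sqrt (real k * l)"
  define \<mu> where "\<mu> = E (\<lambda>u. lin d a u ^ (k + 2))"
  define \<nu> where "\<nu> = 2 * exp (3 / 2) * sqrt l * \<sigma>"
  have \<tau>: "0 < \<tau>" using k l by (simp add: \<tau>_def)
  have \<tau>2: "\<tau>\<^sup>2 = real k * l" using l by (simp add: \<tau>_def)
  have bnorm: "(\<Sum>\<alpha>\<in>?I. (b \<alpha>)\<^sup>2) = 1"
    using tensor_power_normsq[of k "vec d a"] a by (simp add: b_def)
  have \<nu>2: "4 * l * exp 3 * \<sigma>\<^sup>2 = \<nu>\<^sup>2"
  proof -
    have "(exp (3 / 2))\<^sup>2 = exp (3 :: real)" by (simp flip: exp_double)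
    then show ?thesis using l by (simp add: \<nu>_def power_mult_distrib)
  qed
  have \<nu>0: "0 \<le> \<nu>" using l sigma_pos by (simp add: \<nu>_def)
  \<comment> \<open>The choice of \<open>\<tau>\<close> makes \<open>sqrt l\<close> equal to
    \<open>\<tau> / sqrt k\<close>, so the signal hypothesis bounds the noise level
    \<open>\<nu>\<close>.\<close>
  have \<nu>\<mu>: "\<nu> \<le> \<epsilon> * \<tau> * \<mu>"
  proof -
    have "\<nu> = \<epsilon> * \<tau> * (2 * exp (3 / 2) / (\<epsilon> * sqrt (real k)) * \<sigma>)"
      using \<epsilon> k by (simp add: \<nu>_def \<tau>_def real_sqrt_mult)
    also have "\<dots> \<le> \<epsilon> * \<tau> * \<mu>"
      unfolding \<mu>_def using \<epsilon> \<tau> by (intro mult_left_mono signal) auto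
    finally show ?thesis .
  qed
  \<comment> \<open>The signal hypothesis exceeds this condition by the factor
    \<open>exp (3 / 2) * sqrt k\<close>.\<close>
  have \<mu>\<sigma>: "2 * \<sigma> \<le> \<epsilon> * real k * \<mu>"
  proof -
    have "1 * 1 \<le> exp (3 / 2) * sqrt (real k)"
      using k2 by (intro mult_mono) auto
    then have "2 * \<sigma> * 1 \<le> 2 * \<sigma> * (exp (3 / 2) * sqrt (real k))"
      using sigma_pos by (intro mult_left_mono) auto
    also have "\<dots> = \<epsilon> * real k * (2 * exp (3 / 2) / (\<epsilon> * sqrt (real k)) * \<sigma>)"
      using \<epsilon> k by (simp add: field_simps)
    also have "\<dots> \<le> \<epsilon> * real k * \<mu>"
      unfolding \<mu>_def using \<epsilon> by (intro mult_left_mono signal) auto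
    finally show ?thesis by simp
  qed
  define F1 where "F1 = {g \<in> space (gauss ?I). B \<le> mtr d (mpow d (X g) (2 * p))}"
  define F2 where "F2 = {g \<in> space (gauss ?I). 2 < (\<Sum>\<alpha>\<in>?I. b \<alpha> * g \<alpha>)}"
  define F where "F = space (gauss ?I) - (F1 \<union> F2)"
  have F1: "F1 \<in> sets (gauss ?I)"
  proof -
    have [measurable]: "(\<lambda>g. mtr d (mpow d (X g) (2 * p))) \<in> borel_measurable (gauss ?I)"
      using trace_moment[of p p] by (intro borel_measurable_integrable) simp
    show ?thesis unfolding F1_def by measurable
  qed
  have F2: "F2 \<in> sets (gauss ?I)" unfolding F2_def by measurable
  have "prob F1 \<le> real d / exp 3 ^ p"
    unfolding F1_def B_def by (rule trace_tail[OF _ sigma_pos p(1)]) simp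
  also have "\<dots> \<le> real d / exp (3 * l)"
    using p by (intro divide_left_mono) (auto simp flip: exp_of_nat2_mult)
  also have "\<dots> = 1 / (real d)\<^sup>2"
    using d by (simp add: exp_of_nat_mult[of 3, simplified] expl power2_eq_square power3_eq_cube)
  also have "\<dots> \<le> 1 / 4"
  proof -
    have "2\<^sup>2 \<le> (real d)\<^sup>2" using d by (intro power_mono) auto
    then show ?thesis using d by (intro divide_left_mono) auto
  qed
  finally have "prob F1 \<le> 1 / 4" .
  moreover have "prob F2 \<le> 1 / 4"
    unfolding F2_def by (rule gauss_linear_tail[OF finite_tensor_index bnorm])
  ultimately have "prob (F1 \<union> F2) \<le> 1 / 2" using measure_Un_le[OF F1 F2] by simp
  then have probF: "1 / 2 \<le> prob F" unfolding F_def using F1 F2 by (subst prob_compl) auto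
  have noise: "\<bar>mqf d (X g) x\<bar> \<le> \<nu>" if g: "g \<in> F" and x: "normsq d x = 1" for g x
  proof -
    have "\<bar>mqf d (X g) x\<bar> ^ (2 * p) \<le> mtr d (mpow d (X g) (2 * p))"
      unfolding p_def by (rule mqf_power_le_trace[OF suppX symX x])
    also have "\<dots> < B" using g by (auto simp: F_def F1_def)
    finally have "(\<bar>mqf d (X g) x\<bar>\<^sup>2) ^ p < (2 * real p * exp 3 * \<sigma>\<^sup>2) ^ p"
      by (simp add: B_def power_mult)
    then have "\<bar>mqf d (X g) x\<bar>\<^sup>2 < 2 * real p * exp 3 * \<sigma>\<^sup>2"
      by (rule power_less_imp_less_base) simp
    also have "\<dots> \<le> 2 * (2 * l) * exp 3 * \<sigma>\<^sup>2"
      using p by (intro mult_right_mono mult_left_mono) auto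
    also have "\<dots> = \<nu>\<^sup>2" using \<nu>2 by simp
    finally have "\<bar>mqf d (X g) x\<bar> < \<nu>" using \<nu>0 by (rule power_less_imp_less_base)
    then show ?thesis by simp
  qed
  have "prob F \<le> exp (2 * \<tau> + \<tau>\<^sup>2 / 2) * prob G"
  proof (rule gauss_shift_measure_le[OF finite_tensor_index bnorm])
    show "0 \<le> \<tau>" using \<tau> by simp
    show "F \<in> sets (gauss ?I)" using F1 F2 by (auto simp: F_def)
    show "G \<in> sets (gauss ?I)" using G by (simp add: gaussian_tensor_def)
    fix g assume g: "g \<in> F"
    then show "(\<Sum>\<alpha>\<in>?I. b \<alpha> * g \<alpha>) \<le> 2" by (auto simp: F_def F2_def)
    let ?h = "\<lambda>\<alpha>\<in>?I. g \<alpha> + \<tau> * b \<alpha>"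
    have Xh: "(\<Sum>\<alpha>\<in>?I. ?h \<alpha> * moment_matrix k \<alpha> i j)
        = X g i j + \<tau> * (\<Sum>\<alpha>\<in>?I. b \<alpha> * moment_matrix k \<alpha> i j)" for i j
      by (simp add: X_def algebra_simps sum.distrib sum_distrib_left)
    have form: "qform d (\<lambda>(i, j). \<Sum>\<alpha>\<in>?I. ?h \<alpha> * moment_matrix k \<alpha> i j) x
        = \<tau> * E (\<lambda>u. lin d a u ^ k * (lin d x u)\<^sup>2) + mqf d (X g) x" for x
    proof -
      have "qform d (\<lambda>(i, j). \<Sum>\<alpha>\<in>?I. ?h \<alpha> * moment_matrix k \<alpha> i j) x
        = mqf d (X g) x + \<tau> * mqf d (\<lambda>i j. \<Sum>\<alpha>\<in>?I. b \<alpha> * moment_matrix k \<alpha> i j) x"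
        unfolding qform_mqf Xh
        by (simp only: mqf_def distrib_left distrib_right sum.distrib sum_distrib_left mult_ac)
      then show ?thesis by (simp add: b_def mqf_signal)
    qed
    show "?h \<in> G"
    proof (rule good)
      show "?h \<in> space (gaussian_tensor d k)" by (simp add: gaussian_tensor_def space_PiM)
      fix x assume x: "is_top d (\<lambda>(i, j). \<Sum>\<alpha>\<in>?I. ?h \<alpha> * moment_matrix k \<alpha> i j) x"
      then have nx: "normsq d x = 1" by (simp add: is_top_def sphere_fun_def)
      show "1 - 8 * \<epsilon> \<le> (\<Sum>i<d. a i * x i)\<^sup>2"
      proof (rule maximiser_close[OF a nx k deg'(2) \<epsilon> _ \<tau>])
        show "2 * \<sigma> \<le> \<epsilon> * real k * E (\<lambda>u. lin d a u ^ (k + 2))" using \<mu>\<sigma> by (simp add: \<mu>_def)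
        show "\<bar>mqf d (X g) y\<bar> \<le> \<epsilon> * \<tau> * E (\<lambda>u. lin d a u ^ (k + 2))" if "normsq d y = 1" for y
          using noise[OF g that] \<nu>\<mu> by (simp add: \<mu>_def)
        show "\<tau> * E (\<lambda>u. lin d a u ^ k * (lin d a u)\<^sup>2) + mqf d (X g) a
            \<le> \<tau> * E (\<lambda>u. lin d a u ^ k * (lin d x u)\<^sup>2) + mqf d (X g) x"
          using qform_le_is_top[OF x, of a] a unfolding form by simp
      qed
    qed
  qed
  then have G2: "1 / 2 \<le> exp (2 * \<tau> + \<tau>\<^sup>2 / 2) * prob G" using probF by linarith
  have "1 / real d powr (3 * real k) = exp (- (3 * real k * l))"
    using d by (simp add: powr_def l_def exp_minus field_simps)
  also have "\<dots> \<le> exp (- (2 * \<tau> + \<tau>\<^sup>2 / 2)) * (1 / 2)"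
  proof -
    \<comment> \<open>With \<open>1 \<le> \<tau>\<^sup>2\<close> and
      \<open>ln 2 \<le> \<tau>\<^sup>2 / 2\<close> the exponent
      \<open>2 * \<tau> + \<tau>\<^sup>2 / 2 + ln 2\<close> is at most
      \<open>3 * \<tau>\<^sup>2\<close>, which explains the 3 in the power of
      \<open>d\<close>.\<close>
    have "2 * \<tau> \<le> \<tau>\<^sup>2 + 1" using sum_squares_bound[of \<tau> 1] by simp
    moreover have "1 \<le> \<tau>\<^sup>2 / 2 * 2" "ln 2 \<le> \<tau>\<^sup>2 / 2"
    proof -
      have "2 * l \<le> real k * l" using k2 l by (intro mult_right_mono) auto
      then show "1 \<le> \<tau>\<^sup>2 / 2 * 2" "ln 2 \<le> \<tau>\<^sup>2 / 2" using l l2 unfolding \<tau>2 by linarith+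
    qed
    ultimately have "- (3 * \<tau>\<^sup>2) \<le> - (2 * \<tau> + \<tau>\<^sup>2 / 2) - ln 2" by simp
    then have "exp (- (3 * \<tau>\<^sup>2)) \<le> exp (- (2 * \<tau> + \<tau>\<^sup>2 / 2) - ln 2)" by simp
    also have "\<dots> = exp (- (2 * \<tau> + \<tau>\<^sup>2 / 2)) * (1 / 2)" by (simp only: exp_diff) simp
    finally show ?thesis by (simp add: \<tau>2 mult.assoc)
  qed
  also have "\<dots> \<le> exp (- (2 * \<tau> + \<tau>\<^sup>2 / 2)) * (exp (2 * \<tau> + \<tau>\<^sup>2 / 2) * prob G)"
    by (intro mult_left_mono G2) auto
  also have "\<dots> = prob G" by (simp add: exp_minus field_simps)
  finally show ?thesis by (simp add: gaussian_tensor_def)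
qed

end

section \<open>The case of a vanishing second moment\<close>

context ball_pseudo_distribution
begin

text \<open>A vanishing second moment makes every positive number an admissible
  \<open>\<sigma>\<close>, and \<open>tensor_moment_square_le\<close> then forces all tensor moments
  to be 0.\<close>

lemma contracted_moment_zero:
  assumes z: "second_moment d D = 0\<^sub>m d d" and deg: "2 * (2 * k + 2) \<le> t"
    and \<alpha>: "\<alpha> \<in> tensor_index d k"
  shows "moment_matrix k \<alpha> i j = 0"
proof (cases "i < d \<and> j < d")
  case True
  have "E (\<lambda>u. u $ i * u $ j) = 0" if "i < d" "j < d" for i j
    using arg_cong[OF z, of "\<lambda>A. A $$ (i, j)"] that by (simp add: second_moment_eq)
  then have zero: "E (\<lambda>u. (lin d x u)\<^sup>2) = 0" for x by (simp add: second_moment_form)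
  have "(tensor_moment k \<alpha> i j)\<^sup>2 \<le> s\<^sup>2" if "0 < s" for s
  proof -
    interpret bounded_second_moment d t D s
      by unfold_locales (use that in \<open>auto simp: zero sum_nonneg\<close>)
    show ?thesis using True by (intro tensor_moment_square_le deg \<alpha>) auto
  qed
  \<comment> \<open>A nonzero entry would violate the bound at half its own absolute value.\<close>
  from this[of "\<bar>tensor_moment k \<alpha> i j\<bar> / 2"] have "tensor_moment k \<alpha> i j = 0"
    by (cases "tensor_moment k \<alpha> i j = 0") (auto simp: power_divide)
  then show ?thesis by (simp add: moment_matrix_def)
qed (auto simp: moment_matrix_def)

end

text \<open>If the second moment vanishes, then \<open>contracted_moment d k D g\<close> is 0 for
  every \<open>g\<close> and every unit vector is a top eigenvector. The claim about all top
  eigenvectors is therefore restricted to a nonzero second moment, while the existence claim is made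
  throughout.\<close>

theorem theorem4p1:
  shows "\<exists>C0 C1 C2 C3 :: real. C0 > 0 \<and> C1 > 0 \<and> C2 > 0 \<and> C3 > 0 \<and>
    (\<forall>(d :: nat) (k :: nat) (t :: nat) (\<epsilon> :: real) (D :: real vec \<Rightarrow> real) (a :: real vec).
       k > 0 \<longrightarrow> even k \<longrightarrow> 0 < \<epsilon> \<longrightarrow> \<epsilon> < 1 \<longrightarrow>
       real t \<ge> C0 * real k \<longrightarrow>
       pseudo_distribution d t D \<longrightarrow>
       satisfies d t D [unit_ball_constraint d] \<longrightarrow>
       a \<in> carrier_vec d \<longrightarrow> vnorm a = 1 \<longrightarrow>
       pseudo_expectation D (\<lambda>u. (scalar_prod a u) ^ (k + 2))
         \<ge> C1 / (\<epsilon> * sqrt (real k)) * spectral_norm (second_moment d D) \<longrightarrow>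
       measure (gaussian_tensor d k)
         {g \<in> space (gaussian_tensor d k).
            (\<exists>u. top_eigenvector (contracted_moment d k D g) u
                 \<and> (scalar_prod a u)\<^sup>2 \<ge> 1 - C3 * \<epsilon>) \<and>
            (second_moment d D \<noteq> 0\<^sub>m d d \<longrightarrow>
               (\<forall>u. top_eigenvector (contracted_moment d k D g) u
                    \<longrightarrow> (scalar_prod a u)\<^sup>2 \<ge> 1 - C3 * \<epsilon>))}
         \<ge> 1 / real d powr (C2 * real k))"
\<comment> \<open>The witnesses are the degree factor, the noise constant, the exponent from the
  density of the translate and the loss in \<open>maximiser_close\<close>.\<close>
proof (rule exI[of _ 6], rule exI[of _ "2 * exp (3 / 2)"], rule exI[of _ 3], rule exI[of _ 8],
    intro conjI allI impI)
  fix d k t :: nat and \<epsilon> :: real and D :: "real vec \<Rightarrow> real" and av :: "real vec"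
  assume k: "0 < k" "even k" and \<epsilon>: "0 < \<epsilon>" "\<epsilon> < 1" and t: "6 * real k \<le> real t"
    and pd: "pseudo_distribution d t D" and ball: "satisfies d t D [unit_ball_constraint d]"
    and av: "av \<in> carrier_vec d" "vnorm av = 1"
    and signal: "2 * exp (3 / 2) / (\<epsilon> * sqrt (real k)) * spectral_norm (second_moment d D)
       \<le> pseudo_expectation D (\<lambda>u. (scalar_prod av u) ^ (k + 2))"
  interpret ball_pseudo_distribution d t D by unfold_locales fact+
  let ?M = "gaussian_tensor d k"
  have deg: "6 * k \<le> t" using t by (simp flip: of_nat_mult of_nat_le_iff)
  have k2: "2 \<le> k" using k by (auto elim!: evenE)
  have deg': "2 * (2 * k + 2) \<le> t" using deg k2 by auto
  obtain a where a: "av = vec d a" "\<forall>i\<ge>d. a i = 0" using vec_as_fun[OF av(1)] by blast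
  have na: "normsq d a = 1" using av(2) unfolding a(1) vnorm_vec by simp
  have d0: "0 < d" using na by (cases d) auto
  have inner: "scalar_prod av (vec d x) = (\<Sum>i<d. a i * x i)" for x
    by (simp add: a scalar_prod_def atLeast0LessThan)
  have inner': "scalar_prod av u = lin d a u" if "u \<in> carrier_vec d" for u
    using that by (simp add: a scalar_prod_def atLeast0LessThan)
  define m where "m = (\<lambda>g (i, j). \<Sum>\<alpha>\<in>tensor_index d k. g \<alpha> * moment_matrix k \<alpha> i j)"
  have mom: "moment_matrix k \<alpha> i j = moment_matrix k \<alpha> j i" for \<alpha> i j
    by (auto simp: moment_matrix_def tensor_moment_def mult_ac)
  have msym: "m g (i, j) = m g (j, i)" for g i j
    unfolding m_def prod.case mom[of _ i j] ..
  have "contracted_moment d k D g = mat d d (m g)" for g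
    by (simp add: contracted_moment_eq m_def)
  then have top: "top_eigenvector (contracted_moment d k D g) u \<longleftrightarrow> (\<exists>x. u = vec d x \<and> is_top d (m g) x)" for g u
    using top_eigenvector_iff[where m = "m g" and d = d] msym[of g] d0 by simp
  define G where "G = {g \<in> space ?M. (\<exists>x. is_top d (m g) x \<and> 1 - 8 * \<epsilon> \<le> (\<Sum>i<d. a i * x i)\<^sup>2) \<and>
     (second_moment d D \<noteq> 0\<^sub>m d d \<longrightarrow> (\<forall>x. is_top d (m g) x \<longrightarrow> 1 - 8 * \<epsilon> \<le> (\<Sum>i<d. a i * x i)\<^sup>2))}"
  have event: "{g \<in> space ?M. (\<exists>u. top_eigenvector (contracted_moment d k D g) u
         \<and> (scalar_prod av u)\<^sup>2 \<ge> 1 - 8 * \<epsilon>) \<and>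
      (second_moment d D \<noteq> 0\<^sub>m d d \<longrightarrow> (\<forall>u. top_eigenvector (contracted_moment d k D g) u
         \<longrightarrow> (scalar_prod av u)\<^sup>2 \<ge> 1 - 8 * \<epsilon>))} = G"
    unfolding G_def top by (intro Collect_cong) (auto simp flip: inner)
  have G: "G \<in> sets ?M"
    unfolding G_def
  proof (rule sets_top_event)
    fix i j
    have "(\<lambda>g. \<Sum>\<alpha>\<in>tensor_index d k. g \<alpha> * moment_matrix k \<alpha> i j) \<in> borel_measurable ?M"
      unfolding gaussian_tensor_def by measurable
    then show "(\<lambda>g. m g (i, j)) \<in> borel_measurable ?M" by (simp add: m_def)
  qed
  interpret P: prob_space ?M unfolding gaussian_tensor_def by (rule prob_space_gauss)
  have whole: "1 / real d powr (3 * real k) \<le> measure ?M G" if "G = space ?M"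
  proof -
    have "1 \<le> real d powr (3 * real k)" using d0 by (intro ge_one_powr_ge_zero) auto
    then show ?thesis using d0 by (simp add: that P.prob_space divide_le_eq_1)
  qed
  have "1 / real d powr (3 * real k) \<le> measure ?M G"
  proof (cases "second_moment d D = 0\<^sub>m d d")
    case True
    \<comment> \<open>The form is identically 0, so \<open>a\<close> itself is a maximiser.\<close>
    have "is_top d (m g) a" for g
      using na a(2) contracted_moment_zero[OF True deg']
      by (simp add: is_top_def sphere_fun_def qform_def m_def)
    moreover have "(\<Sum>i<d. a i * a i) = 1" using na by (simp add: power2_eq_square)
    ultimately have "G = space ?M" using True \<epsilon> by (force simp: G_def)
    then show ?thesis by (rule whole)
  next
    case False
    show ?thesis
    proof (cases "d = 1")
      case True
      \<comment> \<open>The unit vectors are plus and minus \<open>a\<close>. This case stands apart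
        because \<open>ln d = 0\<close> leaves no shift, and the claimed probability is 1.\<close>
      have "(\<Sum>i<d. a i * x i)\<^sup>2 = 1" if "is_top d (m g) x" for g x
        using that na by (simp add: is_top_def sphere_fun_def True power_mult_distrib)
      then have "G = space ?M" using is_top_exists[OF d0] \<epsilon> by (force simp: G_def)
      then show ?thesis by (rule whole)
    next
      case d1: False
      let ?s = "spectral_norm (second_moment d D)"
      have "0 < ?s" using spectral_norm_pos False unfolding second_moment_eq by blast
      then interpret bounded_second_moment d t D ?s
        by unfold_locales (auto intro: second_moment_le_spectral)
      show ?thesis
      proof (rule top_event_probability[OF _ k deg \<epsilon>(1) na _ G])
        show "2 \<le> d" using d0 d1 by simp
        show "2 * exp (3 / 2) / (\<epsilon> * sqrt (real k)) * ?s \<le> E (\<lambda>u. lin d a u ^ (k + 2))"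
          using signal inner' E_cong[of "\<lambda>u. (scalar_prod av u) ^ (k + 2)" "\<lambda>u. lin d a u ^ (k + 2)"] by simp
        fix g assume "g \<in> space ?M"
          "\<And>x. is_top d (\<lambda>(i, j). \<Sum>\<alpha>\<in>tensor_index d k. g \<alpha> * moment_matrix k \<alpha> i j) x \<Longrightarrow>
             1 - 8 * \<epsilon> \<le> (\<Sum>i<d. a i * x i)\<^sup>2"
        then show "g \<in> G" using is_top_exists[OF d0, of "m g"] by (auto simp: G_def m_def)
      qed
    qed
  qed
  then show "1 / real d powr (3 * real k) \<le> measure ?M {g \<in> space ?M.
      (\<exists>u. top_eigenvector (contracted_moment d k D g) u \<and> (scalar_prod av u)\<^sup>2 \<ge> 1 - 8 * \<epsilon>) \<and>
      (second_moment d D \<noteq> 0\<^sub>m d d \<longrightarrow> (\<forall>u. top_eigenvector (contracted_moment d k D g) u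
         \<longrightarrow> (scalar_prod av u)\<^sup>2 \<ge> 1 - 8 * \<epsilon>))}"
    unfolding event .
qed simp_all

end
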